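(* Let $k\in\mathbb{N}=\{1,2,\ldots\}$, $c>1$, and $p,q,r\ge0$ with $p+q+r=1$. Assume $0<r<p$. Then $\rho^{(k)}$ is infinitely divisible if and only if $c^k=2$ and $r^2\le p^2q$.
   Context: For $k\in\mathbb{Z}$ let $\{(N_t^{(k)},L_t^{(k)}),t\ge0\}$ be the bivariate compound Poisson process (pure jump, no drift) with $E[e^{i(z_1N_t^{(k)}+z_2L_t^{(k)})}]=\exp[t\int_{\mathbb{R}^2}(e^{i(z_1x_1+z_2x_2)}-1)\nu^{(k)}(dx)]$, where $\nu^{(k)}$ is concentrated on the points $(1,0)$, $(0,1)$, $(1,c^{-k})$ with masses $u,v,w\ge0$ respectively, and $p=u/(u+v+w)$, $q=v/(u+v+w)$, $r=w/(u+v+w)$. Let $T$ be the first jump time of $\{N_t^{(k)}\}$. Define $\rho^{(k)}$ as the distribution of $L_T^{(k)}$. It depends on $u,v,w$ only through $p,q,r$. *)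

theory Defs
  imports "HOL-Probability.Probability"
begin

text \<open>
  Stochastic processes are families \<open>X :: real \<Rightarrow> 'a \<Rightarrow> 'b\<close> indexed by time; only the times
  \<open>t \<ge> 0\<close> are meaningful.
\<close>

definition cadlag :: "(real \<Rightarrow> 'b::topological_space) \<Rightarrow> bool" where
  "cadlag f \<longleftrightarrow>
     (\<forall>t\<ge>0. (f \<longlongrightarrow> f t) (at_right t)) \<and>
     (\<forall>t>0. \<exists>l. (f \<longlongrightarrow> l) (at_left t))"

text \<open>
  Stochastic continuity is not listed separately: it follows from right-continuity at \<open>0\<close> and
  stationarity of the increments.
\<close>

definition levy_process :: "'a measure \<Rightarrow> (real \<Rightarrow> 'a \<Rightarrow> 'b::euclidean_space) \<Rightarrow> bool" where
  "levy_process M X \<longleftrightarrow>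
     prob_space M \<and>
     (\<forall>t\<ge>0. X t \<in> borel_measurable M) \<and>
     (AE \<omega> in M. X 0 \<omega> = 0) \<and>
     (\<forall>(n::nat) (\<tau>::nat \<Rightarrow> real). 0 \<le> \<tau> 0 \<longrightarrow> (\<forall>i<n. \<tau> i < \<tau> (Suc i)) \<longrightarrow>
        prob_space.indep_vars M (\<lambda>_. borel) (\<lambda>i \<omega>. X (\<tau> (Suc i)) \<omega> - X (\<tau> i) \<omega>) {..<n}) \<and>
     (\<forall>s\<ge>0. \<forall>t\<ge>0. distr M borel (\<lambda>\<omega>. X (s + t) \<omega> - X s \<omega>) = distr M borel (X t)) \<and>
     (AE \<omega> in M. cadlag (\<lambda>t. X t \<omega>))"

text \<open>
  The absence of a drift and of a Gaussian part is expressed by the characteristic function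
  together with the finiteness of the jump measure \<open>\<nu>\<close>.
\<close>

definition compound_poisson_process ::
    "'a measure \<Rightarrow> 'b::euclidean_space measure \<Rightarrow> (real \<Rightarrow> 'a \<Rightarrow> 'b) \<Rightarrow> bool" where
  "compound_poisson_process M \<nu> X \<longleftrightarrow>
     levy_process M X \<and>
     finite_measure \<nu> \<and> sets \<nu> = sets borel \<and> emeasure \<nu> {0} = 0 \<and>
     (\<forall>t\<ge>0. \<forall>z. (LINT \<omega>|M. iexp (z \<bullet> X t \<omega>)) =
        exp (complex_of_real t * (LINT x|\<nu>. (iexp (z \<bullet> x) - 1))))"

definition nu :: "real \<Rightarrow> real \<Rightarrow> real \<Rightarrow> real \<Rightarrow> int \<Rightarrow> (real \<times> real) measure" where
  "nu c u v w k =
     distr (point_measure {(1, 0), (0, 1), (1, c powi (- k))}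
              (\<lambda>x. ennreal (if x = (1, 0) then u else if x = (0, 1) then v else w)))
       borel (\<lambda>x. x)"

text \<open>The first jump time of a path; it is \<open>\<infinity>\<close> if the path has no jump.\<close>

definition first_jump_time :: "(real \<Rightarrow> real) \<Rightarrow> ereal" where
  "first_jump_time f = Inf (ereal ` {t. 0 < t \<and> f t \<noteq> Lim (at_left t) f})"

text \<open>
  The law of \<open>L\<close> evaluated at the first jump time \<open>T\<close> of \<open>N\<close>.  As paths are regular only
  almost surely, this random variable is measurable with respect to the completion of \<open>M\<close>.
  On the event \<open>T = \<infinity>\<close> (which is null whenever \<open>N\<close> is not identically \<open>0\<close>)
  \<^const>\<open>real_of_ereal\<close> gives the value at time \<open>0\<close>.
\<close>

definition rho :: "'a measure \<Rightarrow> (real \<Rightarrow> 'a \<Rightarrow> real) \<Rightarrow> (real \<Rightarrow> 'a \<Rightarrow> real) \<Rightarrow> real measure" where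
  "rho M N L =
     distr (completion M) borel
       (\<lambda>\<omega>. L (real_of_ereal (first_jump_time (\<lambda>t. N t \<omega>))) \<omega>)"

primrec convolution_power :: "real measure \<Rightarrow> nat \<Rightarrow> real measure" where
  "convolution_power \<mu> 0 = return borel 0"
| "convolution_power \<mu> (Suc n) = convolution \<mu> (convolution_power \<mu> n)"

definition infinitely_divisible :: "real measure \<Rightarrow> bool" where
  "infinitely_divisible \<mu> \<longleftrightarrow>
     real_distribution \<mu> \<and>
     (\<forall>n\<ge>1. \<exists>\<mu>\<^sub>n. real_distribution \<mu>\<^sub>n \<and> convolution_power \<mu>\<^sub>n n = \<mu>)"

end

theory Submission imports Defs begin

text \<open>
  Put \<open>a = c\<^sup>-\<^sup>k\<close>. Sampling the process on a grid of mesh \<open>h\<close> and letting \<open>h\<close> tend to \<open>0\<close>, the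
  independence of the increments gives a geometric series for the characteristic function of
  \<open>L\<^sub>T\<close>, whose limit is \<open>(p + r e\<^sup>i\<^sup>a\<^sup>z) / (1 - q e\<^sup>i\<^sup>z)\<close>: the law \<open>\<rho>\<close> is the convolution of a geometric
  law and a two-point law on \<open>{0, a}\<close>.

  Suppose \<open>\<rho> = \<mu> \<star> \<mu>\<close>. Since \<open>\<rho>\<close> lives on \<open>[0, \<infinity>)\<close> and charges \<open>0\<close>, so does \<open>\<mu>\<close>, and
  hence \<open>\<mu>\<close> is carried by the points \<open>n\<close> and \<open>n + a\<close>, as \<open>\<rho>\<close> is. To produce the atom of
  \<open>\<rho>\<close> at \<open>a\<close>, \<open>\<mu>\<close> must charge \<open>a\<close>; then \<open>\<rho>\<close> charges \<open>2 a\<close>, which forces \<open>a = 1 / 2\<close>.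
  In that case the generating function \<open>(p + r y) / (1 - q y\<^sup>2)\<close> of \<open>\<rho>\<close> (in the variable
  \<open>y = e\<^sup>i\<^sup>z\<^sup>/\<^sup>2\<close>) is the square of the one of \<open>\<mu>\<close>, thus nonnegative for real \<open>y\<close> with
  \<open>q y\<^sup>2 < 1\<close>; but it is negative just left of \<open>- p / r\<close> if \<open>p\<^sup>2 q < r\<^sup>2\<close>. Conversely, for
  \<open>r\<^sup>2 \<le> p\<^sup>2 q\<close> its logarithm has nonnegative Taylor coefficients apart from the constant one,
  so \<open>\<rho>\<close> is compound Poisson.
\<close>

section \<open>Compound Poisson laws on the natural numbers\<close>

lemma nat_pmf_expectation_sums:
  fixes f :: "nat \<Rightarrow> 'b::{banach, second_countable_topology}"
  assumes "summable (\<lambda>n. norm (pmf P n *\<^sub>R f n))"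
  shows "integrable (measure_pmf P) f"
    and "(\<lambda>n. pmf P n *\<^sub>R f n) sums measure_pmf.expectation P f"
proof -
  have i: "integrable (count_space UNIV) (\<lambda>n. pmf P n *\<^sub>R f n)"
    using assms by (simp add: integrable_count_space_nat_iff)
  then show "integrable (measure_pmf P) f"
    by (simp add: measure_pmf_eq_density integrable_density)
  have "measure_pmf.expectation P f = (\<integral>n. pmf P n *\<^sub>R f n \<partial>count_space UNIV)"
    by (simp add: measure_pmf_eq_density integral_density)
  then show "(\<lambda>n. pmf P n *\<^sub>R f n) sums measure_pmf.expectation P f"
    using sums_integral_count_space_nat[OF i] by simp
qed

text \<open>Adding the bound \<open>B\<close> makes \<open>f\<close> nonnegative, so the identity
  for nonnegative integrals applies; the shift cancels at the end.\<close>

lemma expectation_bind_pmf_real: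
  fixes f :: "'b \<Rightarrow> real"
  assumes bnd: "\<And>x. \<bar>f x\<bar> \<le> B"
  shows "measure_pmf.expectation (bind_pmf P Q) f =
           measure_pmf.expectation P (\<lambda>x. measure_pmf.expectation (Q x) f)"
proof -
  have int: "integrable (measure_pmf R) f" for R
    by (rule measure_pmf.integrable_const_bound[where B = B]) (use bnd in auto)
  have Ebnd: "\<bar>measure_pmf.expectation (Q x) f\<bar> \<le> B" for x
  proof -
    have "\<bar>measure_pmf.expectation (Q x) f\<bar> \<le> measure_pmf.expectation (Q x) (\<lambda>x. \<bar>f x\<bar>)"
      by (rule integral_abs_bound)
    also have "\<dots> \<le> measure_pmf.expectation (Q x) (\<lambda>_. B)"
      by (intro integral_mono integrable_abs int) (use bnd in auto)
    finally show ?thesis by simp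
  qed
  have intE: "integrable (measure_pmf P) (\<lambda>x. measure_pmf.expectation (Q x) f)"
    by (rule measure_pmf.integrable_const_bound[where B = B]) (use Ebnd in auto)
  have nn: "0 \<le> B + f x" for x using bnd[of x] by linarith
  have nnE: "0 \<le> B + measure_pmf.expectation (Q x) f" for x using Ebnd[of x] by linarith
  have shift: "(\<integral>\<^sup>+x. ennreal (B + f x) \<partial>measure_pmf R) =
      ennreal (B + measure_pmf.expectation R f)" for R
    using int[of R] nn by (subst nn_integral_eq_integral) auto
  have "ennreal (B + measure_pmf.expectation (bind_pmf P Q) f) =
      (\<integral>\<^sup>+x. ennreal (B + measure_pmf.expectation (Q x) f) \<partial>measure_pmf P)"
    by (simp flip: shift)
  also have "\<dots> = ennreal (B + measure_pmf.expectation P (\<lambda>x. measure_pmf.expectation (Q x) f))"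
    using intE nnE by (subst nn_integral_eq_integral) auto
  finally have "B + measure_pmf.expectation (bind_pmf P Q) f =
      B + measure_pmf.expectation P (\<lambda>x. measure_pmf.expectation (Q x) f)"
  proof (subst (asm) ennreal_inj)
    show "0 \<le> B + measure_pmf.expectation (bind_pmf P Q) f"
      using integral_nonneg_AE[of "\<lambda>x. B + f x" "measure_pmf (bind_pmf P Q)"] nn int by simp
    show "0 \<le> B + measure_pmf.expectation P (\<lambda>x. measure_pmf.expectation (Q x) f)"
      using integral_nonneg_AE[of "\<lambda>x. B + measure_pmf.expectation (Q x) f" "measure_pmf P"] intE nnE
      by simp
  qed
  then show ?thesis by simp
qed

lemma expectation_bind_pmf_complex:
  fixes f :: "'b \<Rightarrow> complex"
  assumes bnd: "\<And>x. norm (f x) \<le> B"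
  shows "measure_pmf.expectation (bind_pmf P Q) f =
           measure_pmf.expectation P (\<lambda>x. measure_pmf.expectation (Q x) f)"
proof -
  have int: "integrable (measure_pmf R) f" for R
    by (rule measure_pmf.integrable_const_bound[where B = B]) (use bnd in auto)
  have Ebnd: "norm (measure_pmf.expectation (Q x) f) \<le> B" for x
  proof -
    have "norm (measure_pmf.expectation (Q x) f) \<le> measure_pmf.expectation (Q x) (\<lambda>x. norm (f x))"
      by (rule integral_norm_bound)
    also have "\<dots> \<le> measure_pmf.expectation (Q x) (\<lambda>_. B)"
      by (intro integral_mono integrable_norm int) (use bnd in auto)
    finally show ?thesis by simp
  qed
  have intE: "integrable (measure_pmf P) (\<lambda>x. measure_pmf.expectation (Q x) f)"
    by (rule measure_pmf.integrable_const_bound[where B = B]) (use Ebnd in auto)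
  have "\<bar>Re (f x)\<bar> \<le> B" "\<bar>Im (f x)\<bar> \<le> B" for x
    using abs_Re_le_cmod[of "f x"] abs_Im_le_cmod[of "f x"] bnd[of x] by linarith+
  note * = this[THEN expectation_bind_pmf_real, of P Q]
  show ?thesis
    using * by (intro complex_eqI) (simp_all add: int intE flip: integral_Re integral_Im)
qed

primrec iid_sum_pmf :: "nat \<Rightarrow> nat pmf \<Rightarrow> nat pmf" where
  "iid_sum_pmf 0 P = return_pmf 0"
| "iid_sum_pmf (Suc n) P = bind_pmf P (\<lambda>x. map_pmf ((+) x) (iid_sum_pmf n P))"

text \<open>Expectations of \<open>y ^ m\<close> are probability generating functions. On the closed
  unit disc the integrand is bounded by 1, and \<open>y = iexp (z / 2)\<close> later turns them into
  characteristic functions.\<close>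

lemma expectation_iid_sum_pmf:
  fixes y :: complex
  assumes "norm y \<le> 1"
  shows "measure_pmf.expectation (iid_sum_pmf n P) (\<lambda>m. y ^ m) =
           measure_pmf.expectation P (\<lambda>m. y ^ m) ^ n"
proof -
  have "norm (y ^ m) \<le> 1" for m using assms by (simp add: norm_power power_le_one)
  note * = expectation_bind_pmf_complex[OF this]
  show ?thesis by (induction n) (simp_all add: * power_add)
qed

definition compound_poisson_pmf :: "real \<Rightarrow> nat pmf \<Rightarrow> nat pmf" where
  "compound_poisson_pmf l P = bind_pmf (poisson_pmf l) (\<lambda>n. iid_sum_pmf n P)"

lemma expectation_poisson_pmf:
  fixes y :: complex
  assumes "0 < l"
  shows "measure_pmf.expectation (poisson_pmf l) (\<lambda>m. y ^ m) = exp (l * (y - 1))"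
proof -
  have e: "pmf (poisson_pmf l) n *\<^sub>R y ^ n = exp (- l) *\<^sub>R ((l * y) ^ n /\<^sub>R fact n)" for n
    using assms by (simp add: scaleR_conv_of_real field_simps)
  have "summable (\<lambda>n. norm (pmf (poisson_pmf l) n *\<^sub>R y ^ n))"
    unfolding e norm_scaleR[of "exp (- l)"] by (intro summable_mult summable_norm_exp)
  then have "(\<lambda>n. pmf (poisson_pmf l) n *\<^sub>R y ^ n) sums measure_pmf.expectation (poisson_pmf l) (\<lambda>m. y ^ m)"
    by (rule nat_pmf_expectation_sums)
  moreover have "(\<lambda>n. pmf (poisson_pmf l) n *\<^sub>R y ^ n) sums (exp (- l) *\<^sub>R exp (l * y))"
    unfolding e by (intro sums_scaleR_right exp_converges)
  ultimately show ?thesis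
    by (simp add: sums_unique2 scaleR_conv_of_real exp_diff exp_minus field_simps flip: exp_of_real)
qed

lemma expectation_compound_poisson_pmf:
  fixes y :: complex
  assumes "0 < l" "norm y \<le> 1"
  shows "measure_pmf.expectation (compound_poisson_pmf l P) (\<lambda>m. y ^ m) =
           exp (l * (measure_pmf.expectation P (\<lambda>m. y ^ m) - 1))"
proof -
  have "norm (y ^ m) \<le> 1" for m using assms by (simp add: norm_power power_le_one)
  then show ?thesis
    unfolding compound_poisson_pmf_def
    using assms
    by (subst expectation_bind_pmf_complex[where B = 1])
       (simp_all add: expectation_iid_sum_pmf expectation_poisson_pmf)
qed

section \<open>Convolutions of probability measures on the real line\<close>

text \<open>Fubini for the product of two exponentials. The exponent is a general complex number
  because the necessity proof takes one with positive real part, where integrability is no longer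
  automatic.\<close>

lemma
  fixes \<zeta> :: complex
  assumes "real_distribution \<mu>" "real_distribution \<nu>"
    and \<mu>: "integrable \<mu> (\<lambda>x. exp (\<zeta> * of_real x))"
    and \<nu>: "integrable \<nu> (\<lambda>x. exp (\<zeta> * of_real x))"
  shows integrable_exp_convolution: "integrable (\<mu> \<star> \<nu>) (\<lambda>x. exp (\<zeta> * of_real x))"
    and integral_exp_convolution: "(\<integral>x. exp (\<zeta> * of_real x) \<partial>(\<mu> \<star> \<nu>)) =
           (\<integral>x. exp (\<zeta> * of_real x) \<partial>\<mu>) * (\<integral>x. exp (\<zeta> * of_real x) \<partial>\<nu>)"
proof -
  interpret A: real_distribution \<mu> by fact
  interpret B: real_distribution \<nu> by fact
  interpret P: pair_prob_space \<mu> \<nu> ..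
  have [measurable_cong]: "sets \<mu> = sets borel" "sets \<nu> = sets borel" by simp_all
  have int: "integrable (\<mu> \<Otimes>\<^sub>M \<nu>) (\<lambda>(x, y). exp (\<zeta> * of_real x) * exp (\<zeta> * of_real y))"
  proof (rule P.Fubini_integrable)
    show "integrable \<mu> (\<lambda>x. \<integral>y. norm (case (x, y) of (x, y) \<Rightarrow>
        exp (\<zeta> * of_real x) * exp (\<zeta> * of_real y)) \<partial>\<nu>)"
      using integrable_norm[OF \<mu>] by (simp add: norm_mult)
    show "AE x in \<mu>. integrable \<nu> (\<lambda>y. case (x, y) of (x, y) \<Rightarrow>
        exp (\<zeta> * of_real x) * exp (\<zeta> * of_real y))"
      using \<nu> by simp
  qed measurable
  have "(\<integral>x. exp (\<zeta> * of_real x) \<partial>(\<mu> \<star> \<nu>)) =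
      (\<integral>p. (case p of (x, y) \<Rightarrow> exp (\<zeta> * of_real x) * exp (\<zeta> * of_real y)) \<partial>(\<mu> \<Otimes>\<^sub>M \<nu>))"
    unfolding convolution_def
    by (subst integral_distr) (auto intro!: Bochner_Integration.integral_cong simp: algebra_simps exp_add)
  also have "\<dots> = (\<integral>x. \<integral>y. exp (\<zeta> * of_real x) * exp (\<zeta> * of_real y) \<partial>\<nu> \<partial>\<mu>)"
    using P.integral_fst'[OF int] by simp
  finally show "(\<integral>x. exp (\<zeta> * of_real x) \<partial>(\<mu> \<star> \<nu>)) =
      (\<integral>x. exp (\<zeta> * of_real x) \<partial>\<mu>) * (\<integral>x. exp (\<zeta> * of_real x) \<partial>\<nu>)"
    by simp
  show "integrable (\<mu> \<star> \<nu>) (\<lambda>x. exp (\<zeta> * of_real x))"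
    unfolding convolution_def
    by (subst integrable_distr_eq) (use int in \<open>auto simp: distrib_left exp_add case_prod_unfold\<close>)
qed

lemma char_convolution:
  assumes "real_distribution \<mu>" "real_distribution \<nu>"
  shows "char (\<mu> \<star> \<nu>) z = char \<mu> z * char \<nu> z"
proof -
  have int: "integrable \<kappa> (\<lambda>x. exp (\<i> * of_real z * of_real x))" if "real_distribution \<kappa>" for \<kappa>
  proof -
    interpret K: real_distribution \<kappa> by fact
    have [measurable_cong]: "sets \<kappa> = sets borel" by simp
    show ?thesis by (rule K.integrable_const_bound[where B = 1]) auto
  qed
  show ?thesis
    using integral_exp_convolution[OF assms int[OF assms(1)] int[OF assms(2)]]
    by (simp add: char_def mult.assoc)
qed

lemma real_distribution_convolution:
  assumes "real_distribution \<mu>" "real_distribution \<nu>"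
  shows "real_distribution (\<mu> \<star> \<nu>)"
proof -
  interpret A: real_distribution \<mu> by fact
  interpret B: real_distribution \<nu> by fact
  interpret P: pair_prob_space \<mu> \<nu> ..
  have [measurable_cong]: "sets \<mu> = sets borel" "sets \<nu> = sets borel" by simp_all
  show ?thesis unfolding convolution_def by (rule P.real_distribution_distr) measurable
qed

lemma
  assumes "real_distribution \<mu>"
  shows real_distribution_convolution_power: "real_distribution (convolution_power \<mu> n)"
    and char_convolution_power: "char (convolution_power \<mu> n) z = char \<mu> z ^ n"
proof -
  have R: "prob_space (return borel (0::real))" by (rule prob_space_return) simp
  have *: "real_distribution (convolution_power \<mu> n) \<and> char (convolution_power \<mu> n) z = char \<mu> z ^ n"
  proof (induction n)
    case 0
    show ?case
      using R by (simp add: char_def integral_return real_distribution_def real_distribution_axioms_def)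
  next
    case (Suc n)
    then show ?case
      using assms by (simp add: real_distribution_convolution char_convolution)
  qed
  from * show "real_distribution (convolution_power \<mu> n)" by (rule conjunct1)
  from * show "char (convolution_power \<mu> n) z = char \<mu> z ^ n" by (rule conjunct2)
qed

text \<open>The recursion ends in the unit mass at 0; comparing characteristic functions removes
  it.\<close>

lemma convolution_power_2:
  assumes "real_distribution \<mu>"
  shows "convolution_power \<mu> 2 = (\<mu> \<star> \<mu>)"
proof (rule Levy_uniqueness)
  show "real_distribution (convolution_power \<mu> 2)"
    by (rule real_distribution_convolution_power[OF assms])
  show "real_distribution (\<mu> \<star> \<mu>)"
    by (rule real_distribution_convolution[OF assms assms])
  show "char (convolution_power \<mu> 2) = char (\<mu> \<star> \<mu>)"
    by (rule ext) (simp only: char_convolution_power[OF assms] char_convolution[OF assms assms] power2_eq_square)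
qed

text \<open>By Tonelli the absolute moment of the convolution square is the square of the absolute
  moment of \<open>\<mu>\<close>, so finiteness passes back to the factor.\<close>

lemma integrable_exp_convolution_self:
  fixes \<zeta> :: complex
  assumes "real_distribution \<mu>"
    and int: "integrable (\<mu> \<star> \<mu>) (\<lambda>x. exp (\<zeta> * of_real x))"
  shows "integrable \<mu> (\<lambda>x. exp (\<zeta> * of_real x))"
proof -
  interpret A: real_distribution \<mu> by fact
  have [measurable_cong]: "sets \<mu> = sets borel" by simp
  let ?I = "\<integral>\<^sup>+x. ennreal (norm (exp (\<zeta> * of_real x))) \<partial>\<mu>"
  have "(\<integral>\<^sup>+x. ennreal (norm (exp (\<zeta> * of_real x))) \<partial>(\<mu> \<star> \<mu>)) =
      (\<integral>\<^sup>+x. \<integral>\<^sup>+y. ennreal (norm (exp (\<zeta> * of_real x))) * ennreal (norm (exp (\<zeta> * of_real y))) \<partial>\<mu> \<partial>\<mu>)"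
    by (subst nn_integral_convolution)
       (auto simp: A.finite_measure_axioms algebra_simps exp_add norm_mult ennreal_mult')
  also have "\<dots> = ?I * ?I"
    by (simp add: nn_integral_cmult nn_integral_multc)
  finally have "?I * ?I < \<infinity>"
    using int by (simp add: integrable_iff_bounded)
  then have "?I < \<infinity>"
    by (auto simp: ennreal_mult_less_top less_top)
  then show ?thesis
    by (intro integrableI_bounded) auto
qed

text \<open>Fubini for null sets. The nested form allows atoms of a factor to be substituted for
  \<open>x\<close> or \<open>y\<close>.\<close>

lemma AE_convolution_iff:
  assumes "real_distribution \<mu>" "real_distribution \<nu>" and D: "D \<in> sets borel"
  shows "(AE x in \<mu> \<star> \<nu>. x \<in> D) \<longleftrightarrow> (AE x in \<mu>. AE y in \<nu>. x + y \<in> D)"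
proof -
  interpret A: real_distribution \<mu> by fact
  interpret B: real_distribution \<nu> by fact
  interpret P: pair_prob_space \<mu> \<nu> ..
  have [measurable_cong]: "sets \<mu> = sets borel" "sets \<nu> = sets borel" by simp_all
  note [measurable] = D
  have "(AE x in \<mu> \<star> \<nu>. x \<in> D) \<longleftrightarrow> (AE p in \<mu> \<Otimes>\<^sub>M \<nu>. fst p + snd p \<in> D)"
    unfolding convolution_def by (subst AE_distr_iff) (auto simp: case_prod_beta)
  also have "\<dots> \<longleftrightarrow> (AE x in \<mu>. AE y in \<nu>. x + y \<in> D)"
  proof (rule P.AE_pair_iff[symmetric])
    show "{p \<in> space (\<mu> \<Otimes>\<^sub>M \<nu>). fst p + snd p \<in> D} \<in> sets (\<mu> \<Otimes>\<^sub>M \<nu>)"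
      by measurable
  qed
  finally show ?thesis .
qed

text \<open>The negated almost-everywhere statement is the way in which "\<open>a\<close> is an
  atom" is expressed below.\<close>

lemma AE_atomD:
  assumes "AE x in M. P x" "\<not> (AE x in M. x \<noteq> a)"
  shows "P a"
  using assms by (metis (mono_tags, lifting) eventually_mono)

lemma real_distribution_distr_pmf: "real_distribution (distr (measure_pmf P) borel f)"
  by (rule prob_space.real_distribution_distr[OF measure_pmf.prob_space_axioms]) simp

section \<open>Infinite divisibility of the convolution of a geometric and a two-point law\<close>

text \<open>The geometric variable counts the jumps \<open>(0, 1)\<close> before the first jump of
  \<open>N\<close>; the Bernoulli variable decides whether that jump is \<open>(1, a)\<close>, which
  has conditional probability \<open>r / (p + r)\<close>.\<close>

definition jump_law :: "real \<Rightarrow> real \<Rightarrow> real \<Rightarrow> real \<Rightarrow> real measure" where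
  "jump_law a p q r =
     (distr (measure_pmf (geometric_pmf (1 - q))) borel real \<star>
      distr (measure_pmf (bernoulli_pmf (r / (p + r)))) borel (\<lambda>b. if b then a else 0))"

context
  fixes a p q r :: real
  assumes a: "0 < a" "a < 1" and r: "0 < r" "r < p" and q: "0 \<le> q" and sum: "p + q + r = 1"
begin

lemma q_less_1: "q < 1" and one_minus_q: "1 - q = p + r"
  using r sum by linarith+

lemma real_distribution_jump_law: "real_distribution (jump_law a p q r)"
  unfolding jump_law_def
  by (intro real_distribution_convolution real_distribution_distr_pmf)

text \<open>Both Bernoulli outcomes have positive probability since \<open>0 < r < p\<close>. The
  support of the geometric law stays implicit because it shrinks to the point 0 when
  \<open>q = 0\<close>.\<close>

lemma AE_jump_law_iff:
  assumes "D \<in> sets borel"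
  shows "(AE x in jump_law a p q r. x \<in> D) \<longleftrightarrow>
           (\<forall>n\<in>set_pmf (geometric_pmf (1 - q)). real n \<in> D \<and> real n + a \<in> D)"
proof -
  have "set_pmf (bernoulli_pmf (r / (p + r))) = UNIV"
    using r by (intro set_pmf_bernoulli) auto
  then show ?thesis
    unfolding jump_law_def using assms
    by (subst AE_convolution_iff)
       (auto simp: real_distribution_distr_pmf AE_distr_iff AE_measure_pmf_iff)
qed

text \<open>The condition on \<open>\<zeta>\<close> is the convergence of the geometric series in
  \<open>q * exp \<zeta>\<close>. It holds on the imaginary axis, as \<open>q < 1\<close>, and also
  on a strip to its right.\<close>

lemma
  fixes \<zeta> :: complex
  assumes \<zeta>: "q * exp (Re \<zeta>) < 1"
  shows integrable_exp_jump_law: "integrable (jump_law a p q r) (\<lambda>x. exp (\<zeta> * of_real x))"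
    and integral_exp_jump_law: "(\<integral>x. exp (\<zeta> * of_real x) \<partial>jump_law a p q r) =
      (p + r * exp (a * \<zeta>)) / (1 - q * exp \<zeta>)"
proof -
  let ?G = "geometric_pmf (1 - q)" and ?B = "bernoulli_pmf (r / (p + r))"
  let ?g = "distr (measure_pmf ?G) borel real"
  let ?b = "distr (measure_pmf ?B) borel (\<lambda>b. if b then a else 0)"
  let ?e = "\<lambda>x::real. exp (\<zeta> * of_real x)"
  have rd: "real_distribution ?g" "real_distribution ?b"
    by (rule real_distribution_distr_pmf)+
  have norm_lt: "norm (q * exp \<zeta>) < 1" using \<zeta> q by (simp add: norm_mult)
  have pmf: "pmf ?G n *\<^sub>R ?e (real n) = of_real (1 - q) * (q * exp \<zeta>) ^ n" for n
    using q_less_1 q by (simp add: scaleR_conv_of_real power_mult_distrib exp_of_nat2_mult[symmetric] mult_ac)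
  have "summable (\<lambda>n. norm (pmf ?G n *\<^sub>R ?e (real n)))"
    unfolding pmf norm_mult[of "of_real (1 - q)"] norm_power
    using norm_lt by (intro summable_mult summable_geometric) simp
  note G = nat_pmf_expectation_sums[OF this]
  have "(\<lambda>n. pmf ?G n *\<^sub>R ?e (real n)) sums (of_real (1 - q) * (1 / (1 - q * exp \<zeta>)))"
    unfolding pmf using norm_lt by (intro sums_mult geometric_sums)
  with G(2) have intg: "(\<integral>x. ?e x \<partial>?g) = of_real (1 - q) / (1 - q * exp \<zeta>)"
    by (subst integral_distr) (auto dest: sums_unique2)
  have ig: "integrable ?g ?e" using G(1) by (subst integrable_distr_eq) auto
  have ib: "integrable ?b ?e"
    by (subst integrable_distr_eq) (auto intro!: integrable_measure_pmf_finite)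
  have "r / (p + r) \<in> {0..1}" using r by auto
  then have "(\<integral>x. ?e x \<partial>?b) = (r / (p + r)) *\<^sub>R exp (a * \<zeta>) + (1 - r / (p + r)) *\<^sub>R 1"
    by (subst integral_distr) (auto simp: integral_measure_pmf[of UNIV] UNIV_bool mult_ac)
  also have "\<dots> = (p + r * exp (a * \<zeta>)) / of_real (p + r)"
    using r by (simp add: scaleR_conv_of_real field_simps flip: of_real_add)
  finally have intb: "(\<integral>x. ?e x \<partial>?b) = (p + r * exp (a * \<zeta>)) / of_real (p + r)" .
  show "(\<integral>x. ?e x \<partial>jump_law a p q r) = (p + r * exp (a * \<zeta>)) / (1 - q * exp \<zeta>)"
    unfolding jump_law_def integral_exp_convolution[OF rd ig ib] intg intb
    unfolding one_minus_q
    using r by (simp flip: of_real_add)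
  show "integrable (jump_law a p q r) ?e"
    unfolding jump_law_def by (rule integrable_exp_convolution[OF rd ig ib])
qed

lemma char_jump_law:
  "char (jump_law a p q r) z = (p + r * iexp (a * z)) / (1 - q * iexp z)"
  using integral_exp_jump_law[of "\<i> * z"] q_less_1
  by (simp add: char_def mult_ac)

section \<open>Necessity: convolution square roots of the law\<close>

lemma half_if_convolution_square:
  assumes "real_distribution \<mu>" and eq: "(\<mu> \<star> \<mu>) = jump_law a p q r"
  shows "a = 1 / 2" and "AE x in \<mu>. x \<in> range real \<union> (\<lambda>n. real n + a) ` UNIV"
proof -
  define D where "D = range real \<union> (\<lambda>n. real n + a) ` UNIV"
  have D0: "x \<ge> 0" if "x \<in> D" for x using that a by (auto simp: D_def)
  have ctbl: "C \<in> sets borel" if "countable C" for C :: "real set"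
    by (rule sets.countable) (use that in auto)
  have "countable D" unfolding D_def by auto
  then have Dm [measurable]: "D \<in> sets borel" by (rule ctbl)
  have geo0: "0 \<in> set_pmf (geometric_pmf (1 - q))"
    using q q_less_1 by (simp add: set_pmf_iff)
  note conv = AE_convolution_iff[OF assms(1) assms(1), unfolded eq]
  have "AE x in jump_law a p q r. x \<in> D"
    using AE_jump_law_iff[OF Dm] by (auto simp: D_def)
  then have inD: "AE x in \<mu>. AE y in \<mu>. x + y \<in> D"
    by (subst (asm) conv) auto
  \<comment> \<open>Otherwise some \<open>x < 0\<close> has \<open>x + y \<in> D\<close> for almost
    all \<open>y\<close>; as \<open>D\<close> lies in the nonnegative half line, this forces
    \<open>y > 0\<close> almost everywhere.\<close>
  have nonneg: "AE x in \<mu>. 0 \<le> x"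
  proof (rule ccontr)
    assume contra: "\<not> (AE x in \<mu>. 0 \<le> x)"
    obtain x where x: "x < 0" "AE y in \<mu>. x + y \<in> D"
    proof (rule ccontr)
      assume "\<not> thesis"
      with that have "\<not> (AE y in \<mu>. x + y \<in> D)" if "x < 0" for x using \<open>x < 0\<close> by blast
      with inD have "AE x in \<mu>. 0 \<le> x"
        by (elim eventually_mono) (metis linorder_not_less)
      with contra show False by blast
    qed
    from x(2) have "AE y in \<mu>. 0 \<le> y"
      by eventually_elim (use D0 x(1) in force)
    with contra show False by blast
  qed
  \<comment> \<open>Nonnegative summands add up to 0 only if both vanish, so without an atom of
    \<open>\<mu>\<close> at 0 the convolution could not charge 0.\<close>
  have atom0: "\<not> (AE x in \<mu>. x \<noteq> 0)"
  proof
    assume "AE x in \<mu>. x \<noteq> 0"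
    with nonneg have "AE x in \<mu>. AE y in \<mu>. x + y \<in> - {0}"
    proof eventually_elim
      case (elim x)
      from nonneg show ?case by eventually_elim (use elim in auto)
    qed
    then have "AE x in jump_law a p q r. x \<in> - {0}" by (subst conv) auto
    then show False using geo0 by (subst (asm) AE_jump_law_iff) force+
  qed
  \<comment> \<open>The nested statement is evaluated at the atom \<open>x = 0\<close>.\<close>
  have AED: "AE y in \<mu>. y \<in> D" using AE_atomD[OF inD atom0] by simp
  then show "AE x in \<mu>. x \<in> range real \<union> (\<lambda>n. real n + a) ` UNIV" by (simp add: D_def)
  show "a = 1 / 2"
  proof (rule ccontr)
    assume na: "a \<noteq> 1 / 2"
    \<comment> \<open>Since \<open>0 < a + a < 2\<close>, the only positive integer it could equal
      is 1, excluded by \<open>na\<close>; \<open>a + a = real n + a\<close> would make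
      \<open>a\<close> an integer.\<close>
    have "a + a \<notin> D"
    proof
      assume "a + a \<in> D"
      then consider n where "a + a = real n" | n where "a = real n" by (auto simp: D_def)
      then show False
      proof cases
        case 1
        then have "0 < real n" "real n < 2" using a by linarith+
        then have "n = 1" by linarith
        with 1 na show False by simp
      qed (use a in auto)
    qed
    \<comment> \<open>If \<open>a\<close> were an atom, substituting it for both summands would put
      \<open>a + a\<close> into \<open>D\<close>.\<close>
    then have nea: "AE x in \<mu>. x \<noteq> a"
      using AE_atomD[OF AE_atomD[OF inD], of a a] by blast
    with AED have D': "AE x in \<mu>. x \<in> D - {a}" by eventually_elim auto
    then have "AE x in \<mu>. AE y in \<mu>. x + y \<in> - {a}"
    proof eventually_elim
      case (elim x)
      from D' show ?case
      proof eventually_elim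
        case (elim y)
        \<comment> \<open>Once \<open>a\<close> is removed, \<open>D\<close> has a gap between 0 and
          1, so no sum of two remaining points equals \<open>a\<close>. Yet the law charges
          \<open>a\<close>, through the geometric value 0.\<close>
        have "z = 0 \<or> 1 \<le> z" if z: "z \<in> D - {a}" for z
        proof -
          from z consider n where "z = real n" | n where "z = real n + a" "n \<noteq> 0"
            by (auto simp: D_def)
          then show ?thesis by cases (use a in \<open>auto simp: Suc_le_eq\<close>)
        qed
        from this[OF \<open>x \<in> D - {a}\<close>] this[OF elim] show ?case using a by auto
      qed
    qed
    then have "AE x in jump_law a p q r. x \<in> - {a}" by (subst conv) auto
    then show False using geo0 by (subst (asm) AE_jump_law_iff) force+
  qed
qed

lemma bound_if_convolution_square:
  assumes \<mu>: "real_distribution \<mu>" and eq: "(\<mu> \<star> \<mu>) = jump_law a p q r"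
  shows "r\<^sup>2 \<le> p\<^sup>2 * q"
proof (rule ccontr)
  assume "\<not> r\<^sup>2 \<le> p\<^sup>2 * q"
  then have less: "p\<^sup>2 * q < r\<^sup>2" by simp
  note half = half_if_convolution_square[OF \<mu> eq]
  \<comment> \<open>The reciprocal of \<open>Y2\<close> is the mean of \<open>q\<close> and
    \<open>r\<^sup>2 / p\<^sup>2\<close>, hence strictly between them. This gives both
    \<open>p < r * Y\<close> and \<open>q * Y\<^sup>2 < 1\<close>, and it covers
    \<open>q = 0\<close>.\<close>
  define Y2 where "Y2 = 2 * p\<^sup>2 / (r\<^sup>2 + p\<^sup>2 * q)"
  define Y where "Y = sqrt Y2"
  have den: "0 < r\<^sup>2 + p\<^sup>2 * q" using r q by (simp add: add_pos_nonneg)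
  have "p\<^sup>2 < Y2 * r\<^sup>2"
  proof -
    have "p\<^sup>2 * (p\<^sup>2 * q) < p\<^sup>2 * r\<^sup>2" using less r by (intro mult_strict_left_mono) auto
    then have "p\<^sup>2 * (r\<^sup>2 + p\<^sup>2 * q) < 2 * p\<^sup>2 * r\<^sup>2" by (simp add: distrib_left)
    then have "p\<^sup>2 < 2 * p\<^sup>2 * r\<^sup>2 / (r\<^sup>2 + p\<^sup>2 * q)" by (simp only: pos_less_divide_eq[OF den])
    then show ?thesis by (simp add: Y2_def)
  qed
  then have "sqrt (p\<^sup>2) < sqrt (Y2 * r\<^sup>2)" by (rule real_sqrt_less_mono)
  then have pY: "p < r * Y" using r by (simp add: Y_def real_sqrt_mult mult.commute)
  have Y0: "0 < Y" using den r by (simp add: Y_def Y2_def)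
  then have Y2: "Y\<^sup>2 = Y2" by (simp add: Y_def)
  have qY: "q * Y\<^sup>2 < 1" unfolding Y2 Y2_def using den less by (simp add: field_simps)
  \<comment> \<open>The imaginary part \<open>2 * pi\<close> makes \<open>exp \<zeta>\<close>
    positive but \<open>exp (\<zeta> / 2)\<close> equal to \<open>- Y\<close>: the generating
    function in half-integer powers is evaluated at the negative point \<open>- Y\<close>.\<close>
  define \<zeta> :: complex where "\<zeta> = of_real (2 * ln Y) + 2 * of_real pi * \<i>"
  have expR: "exp (Re \<zeta>) = Y\<^sup>2"
    using Y0 exp_double[of "ln Y"] by (simp add: \<zeta>_def)
  have "exp \<zeta> = of_real (exp (2 * ln Y)) * exp (2 * of_real pi * \<i>)"
    by (simp add: \<zeta>_def exp_add flip: exp_of_real)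
  then have exp1: "exp \<zeta> = of_real (Y\<^sup>2)"
    using expR by (simp add: \<zeta>_def)
  have "\<zeta> / 2 = of_real (ln Y) + of_real pi * \<i>" by (simp add: \<zeta>_def add_divide_distrib)
  then have "exp (\<zeta> / 2) = exp (of_real (ln Y) + of_real pi * \<i>)" by (rule arg_cong)
  then have exph: "exp (\<zeta> / 2) = - of_real Y"
    using Y0 by (simp add: exp_add exp_of_real)
  have lt: "q * exp (Re \<zeta>) < 1" using qY expR by simp
  note E = integral_exp_jump_law[OF lt] integrable_exp_jump_law[OF lt]
  define J where "J = (\<integral>x. exp (\<zeta> * of_real x) \<partial>\<mu>)"
  have int: "integrable \<mu> (\<lambda>x. exp (\<zeta> * of_real x))"
    using E(2) by (intro integrable_exp_convolution_self[OF \<mu>]) (simp add: eq)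
  have "J * J = (p + r * exp (a * \<zeta>)) / (1 - q * exp \<zeta>)"
    using E(1) integral_exp_convolution[OF \<mu> \<mu> int int] by (simp add: eq J_def)
  also have "\<dots> = of_real ((p - r * Y) / (1 - q * Y\<^sup>2))"
    using exph by (simp add: exp1 half(1))
  finally have JJ: "J * J = of_real ((p - r * Y) / (1 - q * Y\<^sup>2))" .
  \<comment> \<open>With \<open>a = 1 / 2\<close> all points carrying \<open>\<mu>\<close> are
    half-integers, where the exponential is a power of \<open>- Y\<close>. Hence \<open>J\<close> is
    real and its square cannot be negative.\<close>
  have im: "Im (exp (\<zeta> * of_real x)) = 0" if x: "x \<in> range real \<union> range (\<lambda>n. real n + a)" for x
  proof -
    from x obtain n :: nat where "2 * x = of_nat n"
    proof (elim UnE rangeE)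
      fix n assume "x = real n"
      then show thesis by (intro that[of "2 * n"]) simp
    next
      fix n assume "x = real n + a"
      then show thesis by (intro that[of "2 * n + 1"]) (simp add: half(1))
    qed
    then have x2: "x = of_nat n / 2" by simp
    have "exp (\<zeta> * of_real x) = exp (of_nat n * (\<zeta> / 2))" unfolding x2 by (simp add: mult.commute)
    also have "\<dots> = exp (\<zeta> / 2) ^ n" by (rule exp_of_nat_mult)
    also have "\<dots> = of_real ((- Y) ^ n)" by (simp add: exph)
    finally show ?thesis by (simp only: Im_complex_of_real)
  qed
  from half(2) have "AE x in \<mu>. Im (exp (\<zeta> * of_real x)) = 0"
    by (rule eventually_mono) (rule im)
  then have "(\<integral>x. Im (exp (\<zeta> * of_real x)) \<partial>\<mu>) = 0" by (rule integral_eq_zero_AE)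
  then have "Im J = 0" using int by (simp add: J_def)
  then have "Re (J * J) \<ge> 0" by simp
  moreover have "(p - r * Y) / (1 - q * Y\<^sup>2) < 0"
    using pY qY by (intro divide_neg_pos) auto
  ultimately show False unfolding JJ by simp
qed

section \<open>Sufficiency: the law as a compound Poisson law on the half-integers\<close>

lemma infinitely_divisible_jump_law:
  assumes half: "a = 1 / 2" and bound: "r\<^sup>2 \<le> p\<^sup>2 * q"
  shows "infinitely_divisible (jump_law a p q r)"
  unfolding infinitely_divisible_def
proof (intro conjI allI impI)
  show rd: "real_distribution (jump_law a p q r)"
    by (rule real_distribution_jump_law)
  fix n :: nat assume n: "1 \<le> n"
  \<comment> \<open>With these constants the generating function factors as
    \<open>p * (1 + s * y) / ((1 - t * y) * (1 + t * y))\<close>.\<close>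
  define s where "s = r / p"
  define t where "t = sqrt q"
  \<comment> \<open>Taylor coefficients of the logarithm \<open>S\<close> below. Division by zero
    gives \<open>l 0 = 0\<close>, the correct constant term.\<close>
  define l where "l m = (t ^ m + (- t) ^ m - (- s) ^ m) / real m" for m
  have s: "0 < s" "s < 1" using r by (auto simp: s_def)
  have q1: "q < 1" using r sum by linarith
  have t: "0 \<le> t" "t < 1" "t * t = q" using q q1 by (auto simp: t_def)
  have "s\<^sup>2 \<le> q" using bound r by (simp add: s_def power_divide field_simps)
  then have "s \<le> t" unfolding t_def by (rule real_le_rsqrt)
  then have pow: "s ^ m \<le> t ^ m" "0 \<le> t ^ m" "0 \<le> s ^ m" for m using s by (auto intro: power_mono)
  \<comment> \<open>For even \<open>m\<close> the numerator is \<open>2 * t ^ m - s ^ m\<close>,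
    nonnegative since \<open>s \<le> t\<close>; this is where the bound enters. For odd
    \<open>m\<close> it is \<open>s ^ m\<close>.\<close>
  have l0: "0 \<le> l m" for m
  proof (cases "even m")
    case True
    then show ?thesis using pow[of m] by (simp add: l_def)
  qed (use pow[of m] in \<open>simp add: l_def\<close>)
  define S :: "complex \<Rightarrow> complex" where "S y = ln (1 + s * y) - ln (1 + - t * y) - ln (1 + t * y)" for y :: complex
  have l_sums: "(\<lambda>m. l m *\<^sub>R y ^ m) sums S y" if y: "norm y \<le> 1" for y :: complex
  proof -
    have lt: "norm (of_real x * y) < 1" if "\<bar>x\<bar> < 1" for x :: real
      using that y mult_le_one[of "\<bar>x\<bar>" "norm y"] mult_left_le[of "norm y" "\<bar>x\<bar>"] by (auto simp: norm_mult)
    have ln: "(\<lambda>m. - ((- (of_real x * y)) ^ m) / of_nat m) sums ln (1 + of_real x * y)" if "\<bar>x\<bar> < 1" for x :: real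
      by (rule Ln_series'[OF lt[OF that]])
    have "(\<lambda>m. - ((- (of_real s * y)) ^ m) / of_nat m - - ((- (of_real (- t) * y)) ^ m) / of_nat m
        - - ((- (of_real t * y)) ^ m) / of_nat m) sums S y"
      unfolding S_def using ln[of s] ln[of "- t"] ln[of t] s t by (intro sums_diff) auto
    also have "(\<lambda>m. - ((- (of_real s * y)) ^ m) / of_nat m - - ((- (of_real (- t) * y)) ^ m) / of_nat m
        - - ((- (of_real t * y)) ^ m) / of_nat m) = (\<lambda>m. l m *\<^sub>R y ^ m)"
    proof
      fix m
      have minus: "(- (of_real x * y)) ^ m = of_real ((- x) ^ m) * y ^ m" for x :: real
        by (simp flip: power_mult_distrib)
      show "- ((- (of_real s * y)) ^ m) / of_nat m - - ((- (of_real (- t) * y)) ^ m) / of_nat m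
          - - ((- (of_real t * y)) ^ m) / of_nat m = l m *\<^sub>R y ^ m"
        unfolding minus by (simp add: l_def scaleR_conv_of_real diff_divide_distrib add_divide_distrib algebra_simps)
    qed
    finally show ?thesis .
  qed
  have expS: "exp (S y) = (1 + s * y) / (1 - q * (y * y))" if y: "norm y \<le> 1" for y :: complex
  proof -
    have nz: "1 + of_real x * y \<noteq> 0" if "\<bar>x\<bar> < 1" for x :: real
    proof
      assume "1 + of_real x * y = 0"
      then have "of_real x * y = -1" by (simp add: add_eq_0_iff)
      then have "norm (of_real x * y) = 1" by simp
      then show False
        using that y mult_left_le[of "norm y" "\<bar>x\<bar>"] by (auto simp: norm_mult)
    qed
    have "exp (S y) = (1 + s * y) / ((1 + - t * y) * (1 + t * y))"
      using nz[of s] nz[of "-t"] nz[of t] s t by (simp add: S_def exp_diff)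
    also have "(1 + - t * y) * (1 + t * y) = 1 - of_real (t * t) * (y * y)" by (simp add: algebra_simps)
    finally show ?thesis by (simp only: t(3))
  qed
  define \<Lambda> where "\<Lambda> = (\<Sum>m. l m)"
  have "summable (\<lambda>m. of_real (l m) :: complex)"
    using l_sums[of 1] by (auto simp: sums_iff scaleR_conv_of_real)
  then have l_summable: "summable l" by (simp only: summable_complex_of_real)
  then have "(\<lambda>m. of_real (l m) :: complex) sums of_real \<Lambda>"
    unfolding \<Lambda>_def by (intro sums_of_real summable_sums)
  with l_sums[of 1] have S1: "S 1 = of_real \<Lambda>"
    by (auto simp: scaleR_conv_of_real dest: sums_unique2)
  \<comment> \<open>The coefficient \<open>l 1\<close> equals \<open>s > 0\<close>, so the total
    mass \<open>\<Lambda>\<close> is positive and \<open>l\<close> can be normalised to a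
    probability law.\<close>
  have "l 1 \<le> \<Lambda>" unfolding \<Lambda>_def using l_summable l0 sum_le_suminf[of l "{1}"] by simp
  then have \<Lambda>: "0 < \<Lambda>" using s by (simp add: l_def)
  define P where "P = embed_pmf (\<lambda>m. l m / \<Lambda>)"
  have "(\<lambda>m. l m / \<Lambda>) sums 1"
    using sums_divide[OF summable_sums[OF l_summable], of \<Lambda>] \<Lambda> by (simp add: \<Lambda>_def)
  then have "(\<integral>\<^sup>+m. ennreal (l m / \<Lambda>) \<partial>count_space UNIV) = 1"
    using l0 \<Lambda> by (subst nn_integral_count_space_nat) (simp add: suminf_ennreal_eq[where x = 1] sums_iff)
  then have pmfP: "pmf P m = l m / \<Lambda>" for m
    unfolding P_def using l0 \<Lambda> by (intro pmf_embed_pmf) auto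
  have EP: "measure_pmf.expectation P (\<lambda>m. y ^ m) = S y / \<Lambda>" if y: "norm y \<le> 1" for y :: complex
  proof -
    have "norm (pmf P m *\<^sub>R y ^ m) \<le> l m / \<Lambda>" for m
      using y l0 \<Lambda> power_le_one[of "norm y" m]
      by (auto simp: pmfP norm_power divide_simps mult_left_le)
    then have "summable (\<lambda>m. norm (pmf P m *\<^sub>R y ^ m))"
      by (intro summable_comparison_test'[OF summable_divide[OF l_summable, of \<Lambda>], of 0]) auto
    from nat_pmf_expectation_sums(2)[OF this]
    have "(\<lambda>m. (l m / \<Lambda>) *\<^sub>R y ^ m) sums measure_pmf.expectation P (\<lambda>m. y ^ m)"
      by (simp add: pmfP)
    moreover have "(\<lambda>m. (l m *\<^sub>R y ^ m) / \<Lambda>) sums (S y / \<Lambda>)"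
      by (intro sums_divide l_sums y)
    ultimately show ?thesis
      by (auto simp: scaleR_conv_of_real dest: sums_unique2)
  qed
  \<comment> \<open>Dividing the intensity \<open>\<Lambda>\<close> by \<open>n\<close> gives the
    \<open>n\<close>-th convolution root. The factor 1/2 matches
    \<open>y = iexp (z / 2)\<close>.\<close>
  define \<nu> where "\<nu> = distr (measure_pmf (compound_poisson_pmf (\<Lambda> / n) P)) borel (\<lambda>m. real m / 2)"
  have rd\<nu>: "real_distribution \<nu>" unfolding \<nu>_def by (rule real_distribution_distr_pmf)
  have "char (convolution_power \<nu> n) z = char (jump_law a p q r) z" for z
  proof -
    define y where "y = iexp (z / 2)"
    have y: "norm y \<le> 1" by (simp add: y_def)
    have yy: "y * y = iexp z" by (simp add: y_def flip: exp_add)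
    have "char \<nu> z = measure_pmf.expectation (compound_poisson_pmf (\<Lambda> / n) P) (\<lambda>m. y ^ m)"
      unfolding char_def \<nu>_def
      by (subst integral_distr) (auto simp: y_def mult_ac simp flip: exp_of_nat_mult intro!: Bochner_Integration.integral_cong)
    also have "\<dots> = exp (of_real (\<Lambda> / n) * (S y / \<Lambda> - 1))"
      using \<Lambda> n y by (subst expectation_compound_poisson_pmf) (simp_all add: EP)
    finally have "char (convolution_power \<nu> n) z = exp (of_real (\<Lambda> / n) * (S y / \<Lambda> - 1)) ^ n"
      by (simp add: char_convolution_power[OF rd\<nu>])
    also have "\<dots> = exp (of_nat n * (of_real (\<Lambda> / n) * (S y / \<Lambda> - 1)))"
      by (simp only: exp_of_nat_mult)
    also have "of_nat n * (of_real (\<Lambda> / n) * (S y / \<Lambda> - 1)) = S y - S 1"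
      using \<Lambda> n by (simp add: S1 field_simps)
    also have "exp \<dots> = (1 + s * y) / (1 - q * (y * y)) / ((1 + s) / (1 - q))"
      using expS[OF y] expS[of 1] by (simp add: exp_diff)
    also have "\<dots> = of_real ((1 - q) / (1 + s)) * (1 + s * y) / (1 - q * (y * y))"
      by (simp add: mult.commute)
    \<comment> \<open>The normalising constant \<open>exp (- S 1)\<close> is exactly
      \<open>p\<close>, because \<open>p + q + r = 1\<close>.\<close>
    also have "(1 - q) / (1 + s) = p"
    proof -
      have "1 - q = p * (1 + s)" using r sum by (simp add: s_def distrib_left)
      then show ?thesis using s by simp
    qed
    also have "of_real p * (1 + of_real s * y) = of_real p + of_real r * y"
      using r by (simp add: s_def distrib_left)
    finally have "char (convolution_power \<nu> n) z = (p + r * iexp (a * z)) / (1 - q * iexp z)"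
      unfolding yy by (simp add: y_def half)
    then show ?thesis by (simp only: char_jump_law)
  qed
  then have "convolution_power \<nu> n = jump_law a p q r"
    by (intro Levy_uniqueness real_distribution_convolution_power rd\<nu> rd ext)
  then show "\<exists>\<nu>. real_distribution \<nu> \<and> convolution_power \<nu> n = jump_law a p q r"
    using rd\<nu> by blast
qed

text \<open>A convolution root of order 2 alone already forces both conditions.\<close>

theorem infinitely_divisible_jump_law_iff:
  "infinitely_divisible (jump_law a p q r) \<longleftrightarrow> a = 1 / 2 \<and> r\<^sup>2 \<le> p\<^sup>2 * q"
proof
  assume "infinitely_divisible (jump_law a p q r)"
  then obtain \<mu> where \<mu>: "real_distribution \<mu>" "convolution_power \<mu> 2 = jump_law a p q r"
    unfolding infinitely_divisible_def by (metis one_le_numeral)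
  then have "(\<mu> \<star> \<mu>) = jump_law a p q r" by (simp only: convolution_power_2)
  then show "a = 1 / 2 \<and> r\<^sup>2 \<le> p\<^sup>2 * q"
    using half_if_convolution_square(1)[OF \<mu>(1)] bound_if_convolution_square[OF \<mu>(1)] by blast
qed (use infinitely_divisible_jump_law in blast)

end

section \<open>The first jump of an integer-valued path\<close>

text \<open>Distinct integers are at distance at least 1, so right continuity with tolerance 1
  already yields constancy.\<close>

lemma integer_path_locally_constant:
  fixes f :: "real \<Rightarrow> real"
  assumes "(f \<longlongrightarrow> f t) (at_right t)" and "\<And>s. s > t \<Longrightarrow> f s \<in> \<int>" "f t \<in> \<int>"
  obtains e where "e > 0" "\<And>s. t \<le> s \<Longrightarrow> s < t + e \<Longrightarrow> f s = f t"
proof -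
  have "\<forall>\<^sub>F s in at_right t. dist (f s) (f t) < 1"
    using assms(1) by (rule tendstoD) simp
  then obtain b where b: "b > t" "\<And>s. t < s \<Longrightarrow> s < b \<Longrightarrow> dist (f s) (f t) < 1"
    unfolding eventually_at_right_field by blast
  show thesis
  proof (rule that[of "b - t"])
    fix s assume s: "t \<le> s" "s < t + (b - t)"
    show "f s = f t"
    proof (cases "s = t")
      case False
      then have "\<bar>f s - f t\<bar> < 1" "f s \<in> \<int>" using b(2)[of s] s assms(2) by (auto simp: dist_real_def)
      with assms(3) show ?thesis by (auto elim!: Ints_cases)
    qed simp
  qed (use b in auto)
qed

text \<open>The first jump time is the infimum of the times at which the path is nonzero: before it
  the path vanishes, so the left limits up to and including \<open>T\<close> are 0 and the
  \<open>Lim\<close> in \<open>first_jump_time\<close> can be evaluated.\<close>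

lemma integer_path_first_jump:
  fixes f :: "real \<Rightarrow> real"
  assumes f0: "f 0 = 0" and rc: "\<And>t. 0 \<le> t \<Longrightarrow> (f \<longlongrightarrow> f t) (at_right t)"
    and ints: "\<And>t. 0 \<le> t \<Longrightarrow> f t \<in> \<int>" and nz: "0 \<le> t\<^sub>0" "f t\<^sub>0 \<noteq> 0"
  shows "\<exists>T e. 0 < T \<and> first_jump_time f = ereal T \<and> (\<forall>t. 0 \<le> t \<and> t < T \<longrightarrow> f t = 0) \<and>
    0 < e \<and> (\<forall>t. T \<le> t \<and> t < T + e \<longrightarrow> f t \<noteq> 0)"
proof -
  define S where "S = {t. 0 \<le> t \<and> f t \<noteq> 0}"
  define T where "T = Inf S"
  have "S \<noteq> {}" using nz by (auto simp: S_def)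
  moreover have "bdd_below S" by (rule bdd_belowI[of _ 0]) (simp add: S_def)
  ultimately have S: "S \<noteq> {}" "bdd_below S" .
  have T0: "0 \<le> T" unfolding T_def using S by (intro cInf_greatest) (auto simp: S_def)
  have before: "f t = 0" if "0 \<le> t" "t < T" for t
    using cInf_lower[OF _ S(2), of t] that by (auto simp: S_def T_def)
  have "f s \<in> \<int>" if "T < s" for s using T0 that by (intro ints) simp
  then obtain e where e: "e > 0" "\<And>s. T \<le> s \<Longrightarrow> s < T + e \<Longrightarrow> f s = f T"
    by (rule integer_path_locally_constant[OF rc[OF T0] _ ints[OF T0]]) blast+
  \<comment> \<open>If \<open>f T\<close> were 0, local constancy would keep \<open>f\<close> at 0
    up to \<open>T + e\<close>, contradicting the choice of the infimum.\<close>
  have fT: "f T \<noteq> 0"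
  proof
    assume "f T = 0"
    then have "T + e \<le> t" if "t \<in> S" for t
      using that before[of t] e(2)[of t] by (force simp: S_def)
    then have "T + e \<le> T" unfolding T_def using S by (intro cInf_greatest) auto
    with e show False by simp
  qed
  with f0 T0 have T: "0 < T" by (cases "T = 0") auto
  have Lim0: "Lim (at_left t) f = 0" if "0 < t" "t \<le> T" for t
  proof (rule tendsto_Lim)
    have "\<forall>\<^sub>F s in at_left t. f s = 0"
      unfolding eventually_at_left_field using that before by (intro exI[of _ 0]) auto
    then show "(f \<longlongrightarrow> 0) (at_left t)" by (rule tendsto_eventually)
  qed simp
  have jump: "first_jump_time f = ereal T"
    unfolding first_jump_time_def
  proof (rule antisym)
    show "Inf (ereal ` {t. 0 < t \<and> f t \<noteq> Lim (at_left t) f}) \<le> ereal T"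
      using T fT Lim0[of T] by (intro Inf_lower) auto
    show "ereal T \<le> Inf (ereal ` {t. 0 < t \<and> f t \<noteq> Lim (at_left t) f})"
    proof (rule Inf_greatest, safe)
      fix t assume t: "0 < t" "f t \<noteq> Lim (at_left t) f"
      then have "T \<le> t" using Lim0[of t] before[of t] by force
      then show "ereal T \<le> ereal t" by simp
    qed
  qed
  have after: "f t \<noteq> 0" if "T \<le> t" "t < T + e" for t using e(2)[OF that] fT by simp
  show ?thesis using T jump before e(1) after by blast
qed

text \<open>A discretisation of \<open>g\<close> at the first jump of \<open>f\<close> that involves
  countably many times only. If \<open>f\<close> vanishes on the whole grid, the value of
  \<open>LEAST\<close> is unspecified.\<close>

definition grid_value :: "(real \<Rightarrow> real) \<Rightarrow> (real \<Rightarrow> real) \<Rightarrow> real \<Rightarrow> real" where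
  "grid_value f g h = g (real (LEAST i::nat. f (real i * h) \<noteq> 0) * h)"

text \<open>The grid time approaches \<open>T\<close> from the right, so right continuity of
  \<open>g\<close> gives the limit. The interval of length \<open>e\<close> after \<open>T\<close>
  ensures that a fine grid does not miss the jump.\<close>

lemma grid_value_tendsto:
  fixes f g :: "real \<Rightarrow> real"
  assumes f: "f 0 = 0" "\<And>t. 0 \<le> t \<Longrightarrow> (f \<longlongrightarrow> f t) (at_right t)" "\<And>t. 0 \<le> t \<Longrightarrow> f t \<in> \<int>"
      "0 \<le> t\<^sub>0" "f t\<^sub>0 \<noteq> 0"
    and g: "\<And>t. 0 \<le> t \<Longrightarrow> (g \<longlongrightarrow> g t) (at_right t)"
    and h: "h \<longlonglongrightarrow> 0" "\<And>m. 0 < h m"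
  shows "(\<lambda>m. grid_value f g (h m)) \<longlonglongrightarrow> g (real_of_ereal (first_jump_time f))"
proof -
  obtain T e where T: "0 < T" "first_jump_time f = ereal T" "\<And>t. 0 \<le> t \<Longrightarrow> t < T \<Longrightarrow> f t = 0"
    "0 < e" "\<And>t. T \<le> t \<Longrightarrow> t < T + e \<Longrightarrow> f t \<noteq> 0"
    using integer_path_first_jump[OF f] by blast
  define \<tau> where "\<tau> m = real (LEAST i::nat. f (real i * h m) \<noteq> 0) * h m" for m
  have bounds: "T \<le> \<tau> m \<and> \<tau> m \<le> T + h m" if m: "h m < e" for m
  proof -
    \<comment> \<open>The first grid index at or after \<open>T\<close>; its time is below
      \<open>T + h m\<close>, hence within the interval where \<open>f\<close> is nonzero.\<close>
    define i where "i = nat \<lceil>T / h m\<rceil>"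
    have "T / h m \<le> real i" "real i < T / h m + 1"
      using T(1) h(2)[of m] by (auto simp: i_def) linarith+
    then have i: "T \<le> real i * h m" "real i * h m < T + h m"
      using h(2)[of m] by (auto simp: field_simps)
    then have nz: "f (real i * h m) \<noteq> 0" using T(5) m by force
    then have "(LEAST i::nat. f (real i * h m) \<noteq> 0) \<le> i" by (rule Least_le)
    then have "\<tau> m \<le> real i * h m" unfolding \<tau>_def using h(2)[of m] by (intro mult_right_mono) auto
    moreover have "f (\<tau> m) \<noteq> 0"
      unfolding \<tau>_def using nz by (rule LeastI)
    then have "T \<le> \<tau> m" using T(3)[of "\<tau> m"] h(2)[of m] by (force simp: \<tau>_def)
    ultimately show ?thesis using i by linarith
  qed
  have ev: "\<forall>\<^sub>F m in sequentially. h m < e" using h(1) T(4) by (rule order_tendstoD)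
  have lim: "\<tau> \<longlonglongrightarrow> T"
  proof (rule tendsto_sandwich)
    show "\<forall>\<^sub>F m in sequentially. T \<le> \<tau> m" "\<forall>\<^sub>F m in sequentially. \<tau> m \<le> T + h m"
      using ev by (eventually_elim, use bounds in blast)+
    show "(\<lambda>m. T + h m) \<longlonglongrightarrow> T" using tendsto_add[OF tendsto_const h(1), of T] by simp
  qed simp
  have ge: "\<forall>\<^sub>F m in sequentially. \<tau> m \<in> {T..}"
    using ev by eventually_elim (use bounds in auto)
  have "continuous (at T within {T..}) g"
    unfolding continuous_within at_within_Ici_at_right using g[of T] T(1) by simp
  from continuous_within_tendsto_compose[OF this ge lim]
  have "(\<lambda>m. g (\<tau> m)) \<longlonglongrightarrow> g T" .
  then show ?thesis by (simp add: T(2) grid_value_def \<tau>_def)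
qed

text \<open>Reduces integrality at all times to countably many, as needed for an almost sure
  statement; the complement of the integers is open.\<close>

lemma right_continuous_integer_path:
  fixes f :: "real \<Rightarrow> real"
  assumes rc: "(f \<longlongrightarrow> f t) (at_right t)" and t: "0 \<le> t"
    and rat: "\<And>q. q \<in> \<rat> \<Longrightarrow> 0 \<le> q \<Longrightarrow> f q \<in> \<int>"
  shows "f t \<in> \<int>"
proof (rule ccontr)
  assume "f t \<notin> \<int>"
  then have "\<forall>\<^sub>F s in at_right t. f s \<in> - \<int>"
    using rc by (intro topological_tendstoD) (auto intro: closed_Ints)
  then obtain b where b: "b > t" "\<And>s. t < s \<Longrightarrow> s < b \<Longrightarrow> f s \<notin> \<int>"
    unfolding eventually_at_right_field by auto
  obtain q where "q \<in> \<rat>" "t < q" "q < b" using Rats_dense_in_real[OF b(1)] by blast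
  with rat[of q] b(2)[of q] t show False by auto
qed

text \<open>Splits according to the step in which \<open>X\<close> first moves:
  \<open>\<alpha>\<close> belongs to the steps before, \<open>\<beta>\<close> to the moving one, and
  the increments of \<open>Y\<close> telescope. The error is confined to paths that do not move in
  the first \<open>n\<close> steps, where the right-hand side is 1.\<close>

lemma grid_decomposition:
  fixes X Y :: "nat \<Rightarrow> real" and z :: real
  assumes "X 0 = 0" "Y 0 = 0"
  defines "K \<equiv> LEAST i. X i \<noteq> 0"
  defines "\<alpha> \<equiv> \<lambda>j. if X (Suc j) - X j = 0 then iexp (z * (Y (Suc j) - Y j)) else 0"
    and "\<beta> \<equiv> \<lambda>j. if X (Suc j) - X j = 0 then 0 else iexp (z * (Y (Suc j) - Y j))"
  shows "norm (iexp (z * Y K) - (\<Sum>i<n. (\<Prod>j<i. \<alpha> j) * \<beta> i)) \<le>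
           (\<Prod>j<n. if X (Suc j) - X j = 0 then 1 else 0)"
proof (cases "\<exists>i\<le>n. X i \<noteq> 0")
  case False
  then have "\<beta> i = 0" if "i < n" for i using that by (simp add: \<beta>_def)
  moreover have "(\<Prod>j<n. if X (Suc j) - X j = 0 then 1 else 0) = (1::real)"
    using False by (intro prod.neutral) auto
  ultimately show ?thesis by simp
next
  case True
  then obtain i where i: "i \<le> n" "X i \<noteq> 0" by blast
  have XK: "X K \<noteq> 0" unfolding K_def using i(2) by (rule LeastI)
  have before: "X j = 0" if "j < K" for j using not_less_Least that by (auto simp: K_def)
  have "K \<le> i" unfolding K_def using i(2) by (rule Least_le)
  \<comment> \<open>The move happens in step \<open>k\<close>, from index \<open>k\<close> to
    \<open>Suc k = K\<close>; \<open>X 0 = 0\<close> excludes \<open>K = 0\<close>.\<close>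
  obtain k where k: "K = Suc k" using XK assms(1) by (cases K) auto
  have "(\<Sum>i<n. (\<Prod>j<i. \<alpha> j) * \<beta> i) = (\<Sum>i\<in>{k}. (\<Prod>j<i. \<alpha> j) * \<beta> i)"
  proof (rule sum.mono_neutral_right)
    show "\<forall>i\<in>{..<n} - {k}. (\<Prod>j<i. \<alpha> j) * \<beta> i = 0"
    proof
      fix i assume "i \<in> {..<n} - {k}"
      then consider "i < k" | "k < i" by force
      then show "(\<Prod>j<i. \<alpha> j) * \<beta> i = 0"
      \<comment> \<open>Earlier terms vanish because \<open>X\<close> has not moved yet, so
        \<open>\<beta> i = 0\<close>; later ones contain the factor
        \<open>\<alpha> k = 0\<close>.\<close>
      proof cases
        case 1
        then show ?thesis using before[of i] before[of "Suc i"] k by (simp add: \<beta>_def)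
      next
        case 2
        moreover have "\<alpha> k = 0" using XK before[of k] k by (simp add: \<alpha>_def)
        ultimately show ?thesis by (auto intro!: prod_zero)
      qed
    qed
  qed (use \<open>K \<le> i\<close> i k in auto)
  also have "\<dots> = (\<Prod>j<k. iexp (z * (Y (Suc j) - Y j))) * iexp (z * (Y (Suc k) - Y k))"
    using XK before k by (auto simp: \<alpha>_def \<beta>_def intro!: prod.cong)
  also have "\<dots> = (\<Prod>j<Suc k. iexp (z * (Y (Suc j) - Y j)))" by simp
  also have "\<dots> = exp (\<Sum>j<Suc k. \<i> * (z * (Y (Suc j) - Y j)))"
    by (subst exp_sum) auto
  also have "(\<Sum>j<Suc k. \<i> * (z * (Y (Suc j) - Y j))) = \<i> * (z * (\<Sum>j<Suc k. Y (Suc j) - Y j))"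
    by (simp only: of_real_sum sum_distrib_left of_real_mult of_real_diff)
  also have "(\<Sum>j<Suc k. Y (Suc j) - Y j) = Y K"
    using sum_lessThan_telescope[of Y "Suc k"] assms(2) k by simp
  finally have "iexp (z * Y K) - (\<Sum>i<n. (\<Prod>j<i. \<alpha> j) * \<beta> i) = 0" by simp
  then show ?thesis by (simp add: prod_nonneg)
qed

section \<open>The law at the first jump\<close>

lemma norm_integral_le_AE:
  fixes f :: "'a \<Rightarrow> 'b::{banach, second_countable_topology}"
  assumes f: "integrable M f" and g: "integrable M g" and le: "AE x in M. norm (f x) \<le> g x"
  shows "norm (\<integral>x. f x \<partial>M) \<le> (\<integral>x. g x \<partial>M)"
proof -
  have "norm (\<integral>x. f x \<partial>M) \<le> (\<integral>x. norm (f x) \<partial>M)" by (rule integral_norm_bound)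
  also have "\<dots> \<le> (\<integral>x. g x \<partial>M)" by (rule integral_mono_AE[OF integrable_norm[OF f] g le])
  finally show ?thesis .
qed

lemma tendsto_exp_quotient:
  fixes c :: complex
  assumes "h \<longlonglongrightarrow> 0" "\<And>m. h m \<noteq> (0 :: real)"
  shows "(\<lambda>m. (exp (h m * c) - 1) / h m) \<longlonglongrightarrow> c"
proof -
  have "((\<lambda>x. exp (x * c)) has_field_derivative c) (at 0)"
    by (auto intro!: derivative_eq_intros)
  then have lim: "((\<lambda>x. (exp (x * c) - 1) / x) \<longlongrightarrow> c) (at 0)"
    by (simp add: has_field_derivative_iff)
  have "filterlim (\<lambda>m. complex_of_real (h m)) (at 0) sequentially"
    using assms by (auto simp: filterlim_at intro!: tendsto_eq_intros)
  from filterlim_compose[OF lim this] show ?thesis .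
qed

text \<open>The numerator is the probability that a Poisson variable with mean
  \<open>h m * c\<close> is at least 2 when \<open>c > 0\<close>; it is of smaller order than
  \<open>h m\<close> since the derivative at 0 vanishes.\<close>

lemma tendsto_one_minus_exp_quotient:
  assumes "h \<longlonglongrightarrow> 0" "\<And>m. h m \<noteq> (0 :: real)"
  shows "(\<lambda>m. (1 - exp (- (h m * c)) * (1 + h m * c)) / h m) \<longlonglongrightarrow> 0"
proof -
  have "((\<lambda>x. exp (- (x * c)) * (1 + x * c)) has_field_derivative 0) (at 0)"
    by (auto intro!: derivative_eq_intros)
  then have "((\<lambda>x. (exp (- (x * c)) * (1 + x * c) - 1) / x) \<longlongrightarrow> 0) (at 0)"
    by (simp add: has_field_derivative_iff)
  from tendsto_minus[OF this]
  have lim: "((\<lambda>x. (1 - exp (- (x * c)) * (1 + x * c)) / x) \<longlongrightarrow> 0) (at 0)"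
    by (simp add: minus_divide_left)
  have "filterlim h (at 0) sequentially" using assms by (auto simp: filterlim_at)
  from filterlim_compose[OF lim this] show ?thesis .
qed

text \<open>The exponent in \<open>char_joint\<close> is the integral over the three atoms of the
  jump measure, already evaluated, with \<open>a\<close> for \<open>c powi (- k)\<close>.\<close>

locale jump_process = prob_space M
  for M :: "'a measure" and N L :: "real \<Rightarrow> 'a \<Rightarrow> real" and u v w a :: real +
  assumes levy: "levy_process M (\<lambda>t \<omega>. (N t \<omega>, L t \<omega>))"
    and char_joint: "\<And>t x y :: real. 0 \<le> t \<Longrightarrow> (LINT \<omega>|M. iexp (x * N t \<omega> + y * L t \<omega>)) =
      exp (t * (u * (iexp x - 1) + v * (iexp y - 1) + w * (iexp (x + a * y) - 1)))"
    and pos: "0 < u" "0 \<le> v" "0 < w"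
begin

abbreviation rate :: real where "rate \<equiv> u + w"

section \<open>Measurability and the Poisson law of \<open>N\<close>\<close>

lemma measurable_pair_process: "0 \<le> t \<Longrightarrow> (\<lambda>\<omega>. (N t \<omega>, L t \<omega>)) \<in> borel_measurable M"
  using levy by (simp add: levy_process_def)

lemma measurable_process:
  assumes "0 \<le> t"
  shows "N t \<in> borel_measurable M" "L t \<in> borel_measurable M"
proof -
  have "fst \<in> borel_measurable (borel :: (real \<times> real) measure)"
       "snd \<in> borel_measurable (borel :: (real \<times> real) measure)"
    by (intro borel_measurable_continuous_onI continuous_intros)+
  from this[THEN measurable_compose[OF measurable_pair_process[OF assms]]]
  show "N t \<in> borel_measurable M" "L t \<in> borel_measurable M" by simp_all
qed

lemma distr_N:
  assumes t: "0 < t"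
  shows "distr M borel (N t) = distr (measure_pmf (poisson_pmf (t * rate))) borel real"
proof (rule Levy_uniqueness)
  note [measurable] = measurable_process[of t]
  show "real_distribution (distr M borel (N t))" using t by (intro real_distribution_distr) measurable
  show "real_distribution (distr (measure_pmf (poisson_pmf (t * rate))) borel real)"
    by (rule real_distribution_distr_pmf)
  show "char (distr M borel (N t)) = char (distr (measure_pmf (poisson_pmf (t * rate))) borel real)"
  proof
    fix z
    have pow: "iexp z ^ n = iexp (z * real n)" for n
      by (simp add: mult_ac flip: exp_of_nat_mult)
    have "char (distr M borel (N t)) z = (LINT \<omega>|M. iexp (z * N t \<omega> + 0 * L t \<omega>))"
      unfolding char_def using t by (subst integral_distr) auto
    also have "\<dots> = exp (of_real (t * rate) * (iexp z - 1))"
      using t by (subst char_joint) (auto simp: algebra_simps)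
    also have "\<dots> = measure_pmf.expectation (poisson_pmf (t * rate)) (\<lambda>n. iexp z ^ n)"
      using t pos by (subst expectation_poisson_pmf) auto
    also have "\<dots> = char (distr (measure_pmf (poisson_pmf (t * rate))) borel real) z"
      unfolding char_def pow by (subst integral_distr) auto
    finally show "char (distr M borel (N t)) z = char (distr (measure_pmf (poisson_pmf (t * rate))) borel real) z" .
  qed
qed

lemma AE_zero: "AE \<omega> in M. N 0 \<omega> = 0" "AE \<omega> in M. L 0 \<omega> = 0"
  using levy by (auto simp: levy_process_def zero_prod_def elim: eventually_mono)

lemma AE_N_Ints:
  assumes "0 \<le> t"
  shows "AE \<omega> in M. N t \<omega> \<in> \<int>"
proof (cases "t = 0")
  case True
  then show ?thesis using AE_zero(1) by (auto elim: eventually_mono)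
next
  case False
  with assms have t: "0 < t" by simp
  note [measurable] = measurable_process[OF assms]
  have [measurable]: "(\<int> :: real set) \<in> sets borel" by (intro borel_closed closed_Ints)
  have "AE x in distr M borel (N t). x \<in> \<int>"
    unfolding distr_N[OF t] by (subst AE_distr_iff) auto
  then show ?thesis by (subst (asm) AE_distr_iff) auto
qed

lemma prob_N:
  assumes t: "0 < t"
  shows "prob {\<omega> \<in> space M. N t \<omega> = 0} = exp (- (t * rate))"
    and "prob {\<omega> \<in> space M. N t \<omega> = 0 \<or> N t \<omega> = 1} = exp (- (t * rate)) * (1 + t * rate)"
proof -
  note [measurable] = measurable_process[of t]
  let ?P = "poisson_pmf (t * rate)"
  have rate: "0 < t * rate" using t pos by simp
  have "prob {\<omega> \<in> space M. N t \<omega> = 0} = measure (distr M borel (N t)) {0}"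
    using t by (subst measure_distr) (auto intro!: arg_cong[where f = prob])
  also have "\<dots> = measure ?P {0}"
    unfolding distr_N[OF t] by (subst measure_distr) (auto intro!: arg_cong[where f = "measure ?P"])
  finally show "prob {\<omega> \<in> space M. N t \<omega> = 0} = exp (- (t * rate))"
    using rate by (simp add: measure_pmf_single)
  have "prob {\<omega> \<in> space M. N t \<omega> = 0 \<or> N t \<omega> = 1} = measure (distr M borel (N t)) {0, 1}"
    using t by (subst measure_distr) (auto intro!: arg_cong[where f = prob])
  also have "\<dots> = measure ?P {0, 1}"
    unfolding distr_N[OF t] by (subst measure_distr) (auto intro!: arg_cong[where f = "measure ?P"])
  finally show "prob {\<omega> \<in> space M. N t \<omega> = 0 \<or> N t \<omega> = 1} = exp (- (t * rate)) * (1 + t * rate)"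
    using rate by (simp add: measure_measure_pmf_finite algebra_simps)
qed

section \<open>Small-time behaviour of \<open>L\<close> without and with a jump of
  \<open>N\<close>\<close>

definition no_jump_char :: "real \<Rightarrow> real \<Rightarrow> complex" where
  "no_jump_char z t = (LINT \<omega>|M. (if N t \<omega> = 0 then iexp (z * L t \<omega>) else 0))"

text \<open>For a grid of mesh \<open>t\<close>, \<open>no_jump_char\<close> is the ratio of the
  geometric series and \<open>jump_char\<close> its leading factor.\<close>

definition jump_char :: "real \<Rightarrow> real \<Rightarrow> complex" where
  "jump_char z t = (LINT \<omega>|M. (if N t \<omega> = 0 then 0 else iexp (z * L t \<omega>)))"

lemma no_jump_char_add_jump_char:
  assumes t: "0 \<le> t"
  shows "no_jump_char z t + jump_char z t = exp (t * (v * (iexp z - 1) + w * (iexp (a * z) - 1)))"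
proof -
  note [measurable] = measurable_process[OF t]
  have "no_jump_char z t + jump_char z t = (LINT \<omega>|M. (if N t \<omega> = 0 then iexp (z * L t \<omega>) else 0) +
      (if N t \<omega> = 0 then 0 else iexp (z * L t \<omega>)))"
    unfolding no_jump_char_def jump_char_def
    by (intro Bochner_Integration.integral_add[symmetric] integrable_const_bound[where B = 1]) auto
  also have "\<dots> = (LINT \<omega>|M. iexp (0 * N t \<omega> + z * L t \<omega>))"
    by (intro Bochner_Integration.integral_cong) auto
  finally show ?thesis using t by (subst (asm) char_joint) auto
qed

text \<open>For integers \<open>n\<close>, the indicator of \<open>n = 0\<close> agrees with \<open>(1 + (- 1)\<^sup>n) / 2\<close> unless
  \<open>n \<notin> {0, 1}\<close>, and two jumps within a short time are unlikely.\<close>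

lemma no_jump_char_approx:
  assumes t: "0 < t"
  shows "norm (no_jump_char z t -
      (exp (t * (v * (iexp z - 1) + w * (iexp (a * z) - 1))) +
       exp (t * (v * (iexp z - 1) - w * (iexp (a * z) + 1) - 2 * u))) / 2)
    \<le> 1 - exp (- (t * rate)) * (1 + t * rate)"
proof -
  note [measurable] = measurable_process[OF less_imp_le[OF t]]
  let ?e = "\<lambda>x \<omega>. iexp (x * N t \<omega> + z * L t \<omega>)"
  have int: "integrable M (?e x)" for x
    by (rule integrable_const_bound[where B = 1]) auto
  have int': "integrable M (\<lambda>\<omega>. if N t \<omega> = 0 then iexp (z * L t \<omega>) else 0)"
    by (rule integrable_const_bound[where B = 1]) auto
  have "exp (t * (v * (iexp z - 1) + w * (iexp (a * z) - 1))) = (LINT \<omega>|M. ?e 0 \<omega>)"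
    using t by (subst char_joint) auto
  \<comment> \<open>At \<open>x = pi\<close> the factor \<open>iexp (x * n)\<close> is the sign
    \<open>(- 1) ^ n\<close> for natural \<open>n\<close>.\<close>
  moreover have "exp (t * (v * (iexp z - 1) - w * (iexp (a * z) + 1) - 2 * u)) = (LINT \<omega>|M. ?e pi \<omega>)"
    using t by (subst char_joint) (auto simp: distrib_left exp_add algebra_simps)
  moreover have "integrable M (\<lambda>\<omega>. (?e 0 \<omega> + ?e pi \<omega>) / 2)"
    by (intro integrable_divide Bochner_Integration.integrable_add int)
  note int_avg = this
  ultimately have eq: "no_jump_char z t -
      (exp (t * (v * (iexp z - 1) + w * (iexp (a * z) - 1))) +
       exp (t * (v * (iexp z - 1) - w * (iexp (a * z) + 1) - 2 * u))) / 2 =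
     (LINT \<omega>|M. (if N t \<omega> = 0 then iexp (z * L t \<omega>) else 0) - (?e 0 \<omega> + ?e pi \<omega>) / 2)"
    by (simp only: no_jump_char_def Bochner_Integration.integral_diff[OF int' int_avg]
        integral_divide_zero Bochner_Integration.integral_add[OF int int])
  have "norm (LINT \<omega>|M. (if N t \<omega> = 0 then iexp (z * L t \<omega>) else 0) - (?e 0 \<omega> + ?e pi \<omega>) / 2) \<le>
      (LINT \<omega>|M. indicator {\<omega> \<in> space M. \<not> (N t \<omega> = 0 \<or> N t \<omega> = 1)} \<omega>)"
  proof (rule norm_integral_le_AE, goal_cases)
    case 3
    have "norm ((if N t \<omega> = 0 then iexp (z * L t \<omega>) else 0) - (?e 0 \<omega> + ?e pi \<omega>) / 2) \<le>
        indicator {\<omega> \<in> space M. \<not> (N t \<omega> = 0 \<or> N t \<omega> = 1)} \<omega>"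
      if \<omega>: "\<omega> \<in> space M" for \<omega>
    proof -
      have "norm ((?e 0 \<omega> + ?e pi \<omega>) / 2) \<le> 1"
        using norm_triangle_ineq[of "?e 0 \<omega>" "?e pi \<omega>"] by (simp add: norm_divide)
      then show ?thesis using \<omega>
        by (cases "N t \<omega> = 0 \<or> N t \<omega> = 1") (auto simp: exp_add distrib_left)
    qed
    then show ?case by (rule AE_I2)
  next
    case 1
    show ?case by (rule Bochner_Integration.integrable_diff[OF int' int_avg])
  next
    case 2
    have "{\<omega> \<in> space M. \<not> (N t \<omega> = 0 \<or> N t \<omega> = 1)} \<in> events" by measurable
    then show ?case by (rule integrable_real_indicator) (simp add: emeasure_eq_measure)
  qed
  also have "\<dots> = prob {\<omega> \<in> space M. \<not> (N t \<omega> = 0 \<or> N t \<omega> = 1)}" by simp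
  also have "\<dots> = 1 - exp (- (t * rate)) * (1 + t * rate)"
    unfolding prob_N(2)[OF t, symmetric] by (rule prob_neg) measurable
  finally show ?thesis by (simp only: eq)
qed

context
  fixes h :: "nat \<Rightarrow> real"
  assumes h: "h \<longlonglongrightarrow> 0" "\<And>m. 0 < h m"
begin

text \<open>Up to smaller order than \<open>h m\<close>, \<open>no_jump_char\<close> is the average
  of two exponentials, so its derivative at 0 is the mean of their exponents.\<close>

lemma no_jump_char_quotient:
  "(\<lambda>m. (1 - no_jump_char z (h m)) / h m) \<longlonglongrightarrow> u + w + v - v * iexp z"
proof -
  let ?c1 = "v * (iexp z - 1) + w * (iexp (a * z) - 1)"
  let ?c2 = "v * (iexp z - 1) - w * (iexp (a * z) + 1) - 2 * u"
  define avg where "avg m = (exp (h m * ?c1) + exp (h m * ?c2)) / 2" for m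
  have h0: "h m \<noteq> 0" for m using h(2)[of m] by simp
  have "(\<lambda>m. ((exp (h m * ?c1) - 1) / h m + (exp (h m * ?c2) - 1) / h m) / 2) \<longlonglongrightarrow> (?c1 + ?c2) / 2"
    by (intro tendsto_intros tendsto_exp_quotient h h0) simp
  also have "(\<lambda>m. ((exp (h m * ?c1) - 1) / h m + (exp (h m * ?c2) - 1) / h m) / 2) = (\<lambda>m. (avg m - 1) / h m)"
    using h0 by (auto simp: avg_def field_simps)
  finally have lim1: "(\<lambda>m. (avg m - 1) / h m) \<longlonglongrightarrow> (?c1 + ?c2) / 2" .
  have lim2: "(\<lambda>m. (no_jump_char z (h m) - avg m) / h m) \<longlonglongrightarrow> 0"
  proof (rule Lim_null_comparison)
    show "\<forall>\<^sub>F m in sequentially. norm ((no_jump_char z (h m) - avg m) / h m) \<le>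
        (1 - exp (- (h m * rate)) * (1 + h m * rate)) / h m"
    proof (intro always_eventually allI)
      fix m
      have "norm (no_jump_char z (h m) - avg m) \<le> 1 - exp (- (h m * rate)) * (1 + h m * rate)"
        unfolding avg_def by (rule no_jump_char_approx[OF h(2)])
      then show "norm ((no_jump_char z (h m) - avg m) / h m) \<le>
        (1 - exp (- (h m * rate)) * (1 + h m * rate)) / h m"
        using h(2)[of m] by (simp add: norm_divide divide_right_mono)
    qed
  qed (rule tendsto_one_minus_exp_quotient[OF h(1) h0])
  from tendsto_minus[OF tendsto_add[OF lim1 lim2]]
  have "(\<lambda>m. - ((avg m - 1) / h m + (no_jump_char z (h m) - avg m) / h m)) \<longlonglongrightarrow> - ((?c1 + ?c2) / 2)"
    by simp
  also have "(\<lambda>m. - ((avg m - 1) / h m + (no_jump_char z (h m) - avg m) / h m)) =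
      (\<lambda>m. (1 - no_jump_char z (h m)) / h m)"
    using h0 by (auto simp: field_simps)
  also have "- ((?c1 + ?c2) / 2) = u + w + v - v * iexp z"
    by (simp add: field_simps)
  finally show ?thesis .
qed

text \<open>Obtained by complement: the two parts add up to the characteristic function of
  \<open>L\<close>, whose derivative at 0 is \<open>?c1\<close>.\<close>

lemma jump_char_quotient:
  "(\<lambda>m. jump_char z (h m) / h m) \<longlonglongrightarrow> u + w * iexp (a * z)"
proof -
  let ?c1 = "v * (iexp z - 1) + w * (iexp (a * z) - 1)"
  have h0: "h m \<noteq> 0" for m using h(2)[of m] by simp
  have "(\<lambda>m. (exp (h m * ?c1) - 1) / h m + (1 - no_jump_char z (h m)) / h m) \<longlonglongrightarrow>
      ?c1 + (u + w + v - v * iexp z)"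
    by (intro tendsto_add tendsto_exp_quotient no_jump_char_quotient h h0)
  also have "(\<lambda>m. (exp (h m * ?c1) - 1) / h m + (1 - no_jump_char z (h m)) / h m) = (\<lambda>m. jump_char z (h m) / h m)"
    unfolding no_jump_char_add_jump_char[OF less_imp_le[OF h(2)], symmetric]
    by (simp flip: add_divide_distrib)
  also have "?c1 + (u + w + v - v * iexp z) = u + w * iexp (a * z)" by (simp add: algebra_simps)
  finally show ?thesis .
qed

lemma char_quotient_limit:
  "(\<lambda>m. jump_char z (h m) / (1 - no_jump_char z (h m))) \<longlonglongrightarrow>
     (u + w * iexp (a * z)) / (u + w + v - v * iexp z)"
proof -
  have h0: "h m \<noteq> 0" for m using h(2)[of m] by simp
  \<comment> \<open>The limit of the denominators has real part at least \<open>u + w > 0\<close>,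
    so the quotient may be passed to the limit.\<close>
  have "Re (v * iexp z) \<le> norm (v * iexp z)" by (rule complex_Re_le_cmod)
  also have "\<dots> = v" using pos by (simp add: norm_mult)
  finally have "0 < Re (u + w + v - v * iexp z)" using pos by simp
  then have nz: "u + w + v - v * iexp z \<noteq> 0" by (metis zero_complex.sel(1) less_irrefl)
  have "(\<lambda>m. (jump_char z (h m) / h m) / ((1 - no_jump_char z (h m)) / h m)) \<longlonglongrightarrow>
     (u + w * iexp (a * z)) / (u + w + v - v * iexp z)"
    by (intro tendsto_divide jump_char_quotient no_jump_char_quotient nz)
  then show ?thesis using h0 by simp
qed

end

text \<open>Collects the pathwise hypotheses of \<open>grid_value_tendsto\<close>. Integrality is
  obtained at rational times first and extended by right continuity.\<close>

lemma AE_regular_path: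
  "AE \<omega> in M. N 0 \<omega> = 0 \<and> L 0 \<omega> = 0 \<and> (\<forall>t\<ge>0. ((\<lambda>t. N t \<omega>) \<longlongrightarrow> N t \<omega>) (at_right t)) \<and>
     (\<forall>t\<ge>0. ((\<lambda>t. L t \<omega>) \<longlongrightarrow> L t \<omega>) (at_right t)) \<and> (\<forall>t\<ge>0. N t \<omega> \<in> \<int>) \<and> (\<exists>t\<ge>0. N t \<omega> \<noteq> 0)"
proof -
  have rat: "AE \<omega> in M. \<forall>t\<in>{t \<in> \<rat>. 0 \<le> t}. N t \<omega> \<in> \<int>"
    using AE_N_Ints by (intro AE_ball_countable') (auto intro: countable_subset[OF _ countable_rat])
  have cad: "AE \<omega> in M. cadlag (\<lambda>t. (N t \<omega>, L t \<omega>))"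
    using levy by (simp add: levy_process_def)
  define \<tau> where "\<tau> n = real (Suc n)" for n
  have \<tau>: "0 < \<tau> n" for n by (simp add: \<tau>_def)
  \<comment> \<open>The probability that \<open>N\<close> vanishes at time \<open>\<tau> n\<close>
    is \<open>exp (- (\<tau> n * rate))\<close>, which tends to 0.\<close>
  have nonzero: "AE \<omega> in M. \<exists>n. N (\<tau> n) \<omega> \<noteq> 0"
  proof -
    note [measurable] = measurable_process(1)[OF less_imp_le[OF \<tau>]]
    let ?Z = "{\<omega> \<in> space M. \<not> (\<exists>n. N (\<tau> n) \<omega> \<noteq> 0)}"
    have Z: "?Z \<in> events" by measurable
    have le: "prob ?Z \<le> exp (- (\<tau> n * rate))" for n
      unfolding prob_N(1)[OF \<tau>, symmetric]
    proof (rule finite_measure_mono)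
      show "{\<omega> \<in> space M. N (\<tau> n) \<omega> = 0} \<in> events" by measurable
    qed auto
    have "(\<lambda>n. exp (- (\<tau> n * rate))) \<longlonglongrightarrow> 0"
    proof -
      have "(\<lambda>n. exp (- rate) ^ Suc n) \<longlonglongrightarrow> 0"
        using pos by (intro LIMSEQ_Suc LIMSEQ_power_zero) simp
      then show ?thesis by (simp only: \<tau>_def exp_of_nat_mult[symmetric] mult_minus_right)
    qed
    then have "prob ?Z \<le> 0" by (rule LIMSEQ_le_const) (use le in blast)
    then have "prob ?Z = 0" by (intro antisym measure_nonneg)
    then show ?thesis using Z by (subst AE_iff_measurable[OF _ refl]) (auto simp: emeasure_eq_measure)
  qed
  from rat cad nonzero AE_zero show ?thesis
  proof eventually_elim
    case (elim \<omega>)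
    have rc: "((\<lambda>t. N t \<omega>) \<longlongrightarrow> N t \<omega>) (at_right t)" "((\<lambda>t. L t \<omega>) \<longlongrightarrow> L t \<omega>) (at_right t)"
      if "0 \<le> t" for t
    proof -
      have "((\<lambda>t. (N t \<omega>, L t \<omega>)) \<longlongrightarrow> (N t \<omega>, L t \<omega>)) (at_right t)"
        using elim(2) that by (simp add: cadlag_def)
      from tendsto_fst[OF this] tendsto_snd[OF this]
      show "((\<lambda>t. N t \<omega>) \<longlongrightarrow> N t \<omega>) (at_right t)" "((\<lambda>t. L t \<omega>) \<longlongrightarrow> L t \<omega>) (at_right t)"
        by simp_all
    qed
    have "N t \<omega> \<in> \<int>" if "0 \<le> t" for t
      using right_continuous_integer_path[OF rc(1)[OF that] that] elim(1) by simp
    moreover have "\<exists>t\<ge>0. N t \<omega> \<noteq> 0" using elim(3) \<tau> less_imp_le by blast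
    ultimately show ?case using rc elim(4,5) by blast
  qed
qed

section \<open>The geometric series over the grid\<close>

lemma measurable_grid_value:
  assumes "0 < h"
  shows "(\<lambda>\<omega>. grid_value (\<lambda>t. N t \<omega>) (\<lambda>t. L t \<omega>) h) \<in> borel_measurable M"
proof -
  have meas: "N (real i * h) \<in> borel_measurable M" "L (real i * h) \<in> borel_measurable M" for i :: nat
    using assms by (intro measurable_process; simp)+
  note [measurable] = meas
  show ?thesis unfolding grid_value_def
    by (rule measurable_compose_countable[where f = "\<lambda>i. L (real i * h)"]) measurable
qed

text \<open>The modulus is at most the probability of \<open>N t = 0\<close>. This makes the
  geometric series converge.\<close>

lemma norm_no_jump_char_less_1:
  assumes t: "0 < t"
  shows "norm (no_jump_char z t) < 1"
proof -
  note [measurable] = measurable_process[OF less_imp_le[OF t]]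
  have "norm (no_jump_char z t) \<le> (LINT \<omega>|M. indicator {\<omega> \<in> space M. N t \<omega> = 0} \<omega>)"
    unfolding no_jump_char_def
    by (rule norm_integral_le_AE) (auto intro!: integrable_const_bound[where B = 1] AE_I2 simp: indicator_def)
  also have "\<dots> = exp (- (t * rate))" using prob_N(1)[OF t] by simp
  also have "\<dots> < 1" using t pos by simp
  finally show ?thesis .
qed

text \<open>Integrates \<open>grid_decomposition\<close>. Increments over grid cells are independent
  and identically distributed, so term \<open>i\<close> contributes
  \<open>no_jump_char z h ^ i * jump_char z h\<close>, and the error after \<open>n\<close> terms is
  the probability that no cell among the first \<open>n\<close> moves \<open>N\<close>.\<close>

lemma char_grid_value:
  assumes h: "0 < h"
  shows "(LINT \<omega>|M. iexp (z * grid_value (\<lambda>t. N t \<omega>) (\<lambda>t. L t \<omega>) h)) =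
    jump_char z h / (1 - no_jump_char z h)"
proof -
  define D where "D i \<omega> = (N (real (Suc i) * h) \<omega>, L (real (Suc i) * h) \<omega>) - (N (real i * h) \<omega>, L (real i * h) \<omega>)"
    for i \<omega>
  have fstsnd [measurable]: "fst \<in> borel_measurable (borel :: (real \<times> real) measure)"
       "snd \<in> borel_measurable (borel :: (real \<times> real) measure)"
    by (intro borel_measurable_continuous_onI continuous_intros)+
  have indep: "indep_vars (\<lambda>_. borel) D {..<n}" for n
  proof -
    have ind: "indep_vars (\<lambda>_. borel) (\<lambda>i \<omega>. (N (\<tau> (Suc i)) \<omega>, L (\<tau> (Suc i)) \<omega>) - (N (\<tau> i) \<omega>, L (\<tau> i) \<omega>)) {..<n}"
      if "0 \<le> \<tau> 0" "\<forall>i<n. \<tau> i < \<tau> (Suc i)" for \<tau> :: "nat \<Rightarrow> real"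
      using levy that unfolding levy_process_def by blast
    have "indep_vars (\<lambda>_. borel) (\<lambda>i \<omega>. (N (real (Suc i) * h) \<omega>, L (real (Suc i) * h) \<omega>) -
        (N (real i * h) \<omega>, L (real i * h) \<omega>)) {..<n}"
      by (rule ind[of "\<lambda>i. real i * h"]) (use h in simp_all)
    then show ?thesis by (simp only: D_def[abs_def])
  qed
  have D_meas [measurable]: "D i \<in> borel_measurable M" for i
    unfolding D_def[abs_def] using h
    by (intro borel_measurable_diff measurable_pair_process) auto
  have distr_D: "distr M borel (D i) = distr M borel (\<lambda>\<omega>. (N h \<omega>, L h \<omega>))" for i
  proof -
    have "distr M borel (\<lambda>\<omega>. (N (s + t) \<omega>, L (s + t) \<omega>) - (N s \<omega>, L s \<omega>)) =
        distr M borel (\<lambda>\<omega>. (N t \<omega>, L t \<omega>))" if "0 \<le> s" "0 \<le> t" for s t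
      using levy that by (simp add: levy_process_def)
    from this[of "real i * h" h] h show ?thesis by (simp add: D_def[abs_def] algebra_simps)
  qed
  have int_D: "(LINT \<omega>|M. F (D i \<omega>)) = (LINT \<omega>|M. F (N h \<omega>, L h \<omega>))"
    if [measurable]: "F \<in> borel_measurable borel" for F :: "real \<times> real \<Rightarrow> complex" and i
  proof -
    have "(LINT \<omega>|M. F (D i \<omega>)) = (LINT x|distr M borel (D i). F x)"
      by (subst integral_distr) auto
    also have "\<dots> = (LINT \<omega>|M. F (N h \<omega>, L h \<omega>))"
      unfolding distr_D using measurable_pair_process[of h] h by (subst integral_distr) auto
    finally show ?thesis .
  qed
  \<comment> \<open>Applied to the increments, \<open>F\<close>, \<open>G\<close> and
    \<open>I\<close> are the factors \<open>\<alpha>\<close>, \<open>\<beta>\<close> and the error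
    factor of \<open>grid_decomposition\<close>.\<close>
  define F where "F x = (if fst x = 0 then iexp (z * snd x) else 0)" for x :: "real \<times> real"
  define G where "G x = (if fst x = 0 then 0 else iexp (z * snd x))" for x :: "real \<times> real"
  define I where "I x = (if fst x = 0 then 1 else 0 :: real)" for x :: "real \<times> real"
  have meas [measurable]: "F \<in> borel_measurable borel" "G \<in> borel_measurable borel" "I \<in> borel_measurable borel"
    unfolding F_def[abs_def] G_def[abs_def] I_def[abs_def] by measurable
  have norms: "norm (F x) \<le> 1" "norm (G x) \<le> 1" "norm (I x) \<le> 1" for x
    by (auto simp: F_def G_def I_def)
  have EF: "(LINT \<omega>|M. F (D i \<omega>)) = no_jump_char z h" and EG: "(LINT \<omega>|M. G (D i \<omega>)) = jump_char z h" for i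
    by (simp_all only: int_D meas) (simp_all only: F_def G_def fst_conv snd_conv no_jump_char_def jump_char_def)
  have EI: "(LINT \<omega>|M. I (D i \<omega>)) = exp (- (h * rate))" for i
  proof -
    note [measurable] = measurable_process[OF less_imp_le[OF h]]
    \<comment> \<open>\<open>int_D\<close> concerns complex integrands, hence the detour through
      \<open>complex_of_real\<close>.\<close>
    have "of_real (LINT \<omega>|M. I (D i \<omega>)) = (LINT \<omega>|M. complex_of_real (I (D i \<omega>)))"
      by (rule integral_complex_of_real[symmetric])
    also have "\<dots> = (LINT \<omega>|M. complex_of_real (I (N h \<omega>, L h \<omega>)))"
      by (rule int_D[of "\<lambda>x. complex_of_real (I x)"]) measurable
    also have "\<dots> = of_real (LINT \<omega>|M. I (N h \<omega>, L h \<omega>))"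
      by (rule integral_complex_of_real)
    also have "(LINT \<omega>|M. I (N h \<omega>, L h \<omega>)) = (LINT \<omega>|M. indicator {\<omega> \<in> space M. N h \<omega> = 0} \<omega>)"
      by (intro Bochner_Integration.integral_cong) (auto simp: I_def)
    also have "\<dots> = exp (- (h * rate))" using prob_N(1)[OF h] by simp
    finally show ?thesis by (simp only: of_real_eq_iff)
  qed
  have prod_FG: "(LINT \<omega>|M. (\<Prod>j<i. F (D j \<omega>)) * G (D i \<omega>)) = no_jump_char z h ^ i * jump_char z h"
      "integrable M (\<lambda>\<omega>. (\<Prod>j<i. F (D j \<omega>)) * G (D i \<omega>))" for i
  proof -
    \<comment> \<open>Writing the term as one product over \<open>Suc i\<close> cells lets
      independence be applied to all its factors at once.\<close>
    define H where "H j = (if j < i then F else G)" for j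
    have [measurable]: "H j \<in> borel_measurable borel" for j by (simp add: H_def)
    have ind: "indep_vars (\<lambda>_. borel) (\<lambda>j \<omega>. H j (D j \<omega>)) {..<Suc i}"
      by (rule indep_vars_compose2[OF indep]) measurable
    have int: "integrable M (\<lambda>\<omega>. H j (D j \<omega>))" for j
      by (rule integrable_const_bound[where B = 1]) (auto simp: H_def norms)
    have eq: "(\<Prod>j<i. F (D j \<omega>)) * G (D i \<omega>) = (\<Prod>j<Suc i. H j (D j \<omega>))" for \<omega>
      by (simp add: H_def)
    have "(LINT \<omega>|M. (\<Prod>j<Suc i. H j (D j \<omega>))) = (\<Prod>j<Suc i. LINT \<omega>|M. H j (D j \<omega>))"
      by (rule indep_vars_lebesgue_integral[OF _ ind int]) simp
    also have "\<dots> = no_jump_char z h ^ i * jump_char z h" by (simp add: H_def EF EG)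
    finally show "(LINT \<omega>|M. (\<Prod>j<i. F (D j \<omega>)) * G (D i \<omega>)) = no_jump_char z h ^ i * jump_char z h"
      by (simp only: eq)
    show "integrable M (\<lambda>\<omega>. (\<Prod>j<i. F (D j \<omega>)) * G (D i \<omega>))"
      unfolding eq by (rule indep_vars_integrable[OF _ ind int]) simp
  qed
  have prod_I: "(LINT \<omega>|M. (\<Prod>j<n. I (D j \<omega>))) = exp (- (h * rate)) ^ n"
      "integrable M (\<lambda>\<omega>. (\<Prod>j<n. I (D j \<omega>)))" for n
  proof -
    have ind: "indep_vars (\<lambda>_. borel) (\<lambda>j \<omega>. I (D j \<omega>)) {..<n}"
      by (rule indep_vars_compose2[OF indep]) measurable
    have int: "integrable M (\<lambda>\<omega>. I (D j \<omega>))" for j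
      by (rule integrable_const_bound[where B = 1]) (use norms in auto)
    show "(LINT \<omega>|M. (\<Prod>j<n. I (D j \<omega>))) = exp (- (h * rate)) ^ n"
      using indep_vars_lebesgue_integral[OF _ ind int] by (simp add: EI)
    show "integrable M (\<lambda>\<omega>. (\<Prod>j<n. I (D j \<omega>)))"
      by (rule indep_vars_integrable[OF _ ind int]) simp
  qed
  let ?V = "\<lambda>\<omega>. grid_value (\<lambda>t. N t \<omega>) (\<lambda>t. L t \<omega>) h"
  note [measurable] = measurable_grid_value[OF h]
  have intV: "integrable M (\<lambda>\<omega>. iexp (z * ?V \<omega>))"
    by (rule integrable_const_bound[where B = 1]) auto
  have bound: "norm ((LINT \<omega>|M. iexp (z * ?V \<omega>)) - (\<Sum>i<n. no_jump_char z h ^ i * jump_char z h))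
      \<le> exp (- (h * rate)) ^ n" for n
  proof -
    have intS: "integrable M (\<lambda>\<omega>. \<Sum>i<n. (\<Prod>j<i. F (D j \<omega>)) * G (D i \<omega>))"
      by (intro Bochner_Integration.integrable_sum prod_FG)
    have "(LINT \<omega>|M. iexp (z * ?V \<omega>)) - (\<Sum>i<n. no_jump_char z h ^ i * jump_char z h) =
        (LINT \<omega>|M. iexp (z * ?V \<omega>) - (\<Sum>i<n. (\<Prod>j<i. F (D j \<omega>)) * G (D i \<omega>)))"
      by (simp only: Bochner_Integration.integral_diff[OF intV intS] Bochner_Integration.integral_sum[OF prod_FG(2)] prod_FG(1))
    also have "norm \<dots> \<le> (LINT \<omega>|M. (\<Prod>j<n. I (D j \<omega>)))"
    proof (rule norm_integral_le_AE)
      show "AE \<omega> in M. norm (iexp (z * ?V \<omega>) - (\<Sum>i<n. (\<Prod>j<i. F (D j \<omega>)) * G (D i \<omega>))) \<le> (\<Prod>j<n. I (D j \<omega>))"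
        using AE_zero
      proof eventually_elim
        case (elim \<omega>)
        show ?case
          using grid_decomposition[of "\<lambda>i. N (real i * h) \<omega>" "\<lambda>i. L (real i * h) \<omega>" z n] elim
          by (simp only: grid_value_def F_def G_def I_def D_def fst_diff snd_diff fst_conv snd_conv of_nat_0 mult_zero_left simp_thms)
      qed
    qed (intro Bochner_Integration.integrable_diff intV intS prod_I)+
    finally show ?thesis by (simp only: prod_I(1))
  qed
  have "(\<lambda>n. \<Sum>i<n. no_jump_char z h ^ i * jump_char z h) \<longlonglongrightarrow> (LINT \<omega>|M. iexp (z * ?V \<omega>))"
  proof (rule LIM_zero_cancel, rule Lim_null_comparison)
    show "\<forall>\<^sub>F n in sequentially. norm ((\<Sum>i<n. no_jump_char z h ^ i * jump_char z h) - (LINT \<omega>|M. iexp (z * ?V \<omega>)))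
        \<le> exp (- (h * rate)) ^ n"
      using bound by (auto simp: norm_minus_commute)
    show "(\<lambda>n. exp (- (h * rate)) ^ n) \<longlonglongrightarrow> 0"
      using h pos by (intro LIMSEQ_power_zero) simp
  qed
  moreover have "(\<lambda>n. \<Sum>i<n. no_jump_char z h ^ i * jump_char z h) \<longlonglongrightarrow> 1 / (1 - no_jump_char z h) * jump_char z h"
    using sums_mult2[OF geometric_sums[OF norm_no_jump_char_less_1[OF h]]] by (simp add: sums_def)
  ultimately show ?thesis by (simp add: LIMSEQ_unique)
qed

text \<open>Along the meshes \<open>2 ^ (- m)\<close> the grid values converge almost surely to
  \<open>L\<close> at the first jump, and dominated convergence carries their characteristic
  functions to the limit.\<close>

lemma
  shows real_distribution_rho: "real_distribution (rho M N L)"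
    and char_rho: "char (rho M N L) z = (u + w * iexp (a * z)) / (u + w + v - v * iexp z)"
proof -
  define h where "h m = (1 / 2 :: real) ^ m" for m
  have h: "h \<longlonglongrightarrow> 0" "0 < h m" for m
    unfolding h_def by (intro LIMSEQ_power_zero, simp) simp
  let ?V = "\<lambda>m \<omega>. grid_value (\<lambda>t. N t \<omega>) (\<lambda>t. L t \<omega>) (h m)"
  let ?H = "\<lambda>\<omega>. L (real_of_ereal (first_jump_time (\<lambda>t. N t \<omega>))) \<omega>"
  \<comment> \<open>A version of \<open>L\<close> at the first jump that is measurable for
    \<open>M\<close> itself, being a limit of measurable grid values.\<close>
  define V where "V \<omega> = lim (\<lambda>m. ?V m \<omega>)" for \<omega>
  note [measurable] = measurable_grid_value[OF h(2)]
  have V_meas [measurable]: "V \<in> borel_measurable M" unfolding V_def[abs_def] by measurable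
  have conv: "AE \<omega> in M. (\<lambda>m. ?V m \<omega>) \<longlonglongrightarrow> ?H \<omega>"
    using AE_regular_path
  proof eventually_elim
    case (elim \<omega>)
    then obtain t0 where "0 \<le> t0" "N t0 \<omega> \<noteq> 0" by blast
    with elim h show ?case
      by (intro grid_value_tendsto[of "\<lambda>t. N t \<omega>" t0 "\<lambda>t. L t \<omega>" h]) auto
  qed
  then have eq: "AE \<omega> in M. V \<omega> = ?H \<omega>"
    unfolding V_def by eventually_elim (rule limI)
  have V_meas': "V \<in> borel_measurable (completion M)" by (rule measurable_completion) measurable
  \<comment> \<open>Differing from \<open>V\<close> on a null set only, the variable is measurable
    for the completion, so both have the same law.\<close>
  have "?H \<in> borel_measurable (completion M)"
  proof (rule measurableI)
    fix A :: "real set" assume A: "A \<in> sets borel"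
    show "?H -` A \<inter> space (completion M) \<in> sets (completion M)"
    proof (rule completion.in_sets_AE)
      show "V -` A \<inter> space (completion M) \<in> sets (completion M)"
        using V_meas' A by (rule measurable_sets)
      show "AE \<omega> in completion M. \<omega> \<in> V -` A \<inter> space (completion M) \<longleftrightarrow> \<omega> \<in> ?H -` A \<inter> space (completion M)"
        using AE_completion[OF eq] by eventually_elim auto
    qed auto
  qed auto
  then have rho: "rho M N L = distr M borel V"
    unfolding rho_def distr_completion[OF V_meas, symmetric]
    using AE_completion[OF eq] V_meas'
    by (intro distr_cong_AE) (auto elim: eventually_mono)
  show "real_distribution (rho M N L)" unfolding rho by (rule real_distribution_distr) measurable
  have "(\<lambda>m. LINT \<omega>|M. iexp (z * ?V m \<omega>)) \<longlonglongrightarrow> (LINT \<omega>|M. iexp (z * V \<omega>))"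
  proof (rule integral_dominated_convergence[where w = "\<lambda>_. 1"])
    show "AE \<omega> in M. (\<lambda>m. iexp (z * ?V m \<omega>)) \<longlonglongrightarrow> iexp (z * V \<omega>)"
      using conv eq
    proof eventually_elim
      case (elim \<omega>)
      then show ?case by (auto intro!: tendsto_intros)
    qed
  qed auto
  moreover have "(\<lambda>m. LINT \<omega>|M. iexp (z * ?V m \<omega>)) \<longlonglongrightarrow> (u + w * iexp (a * z)) / (u + w + v - v * iexp z)"
    unfolding char_grid_value[OF h(2)] by (rule char_quotient_limit[OF h])
  ultimately have "(LINT \<omega>|M. iexp (z * V \<omega>)) = (u + w * iexp (a * z)) / (u + w + v - v * iexp z)"
    by (rule LIMSEQ_unique)
  then show "char (rho M N L) z = (u + w * iexp (a * z)) / (u + w + v - v * iexp z)"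
    unfolding rho char_def by (subst integral_distr) auto
qed

end

section \<open>From the jump measure to the characteristic exponent\<close>

lemma integral_nu:
  fixes f :: "real \<times> real \<Rightarrow> complex"
  assumes [measurable]: "f \<in> borel_measurable borel" and "0 \<le> u" "0 \<le> v" "0 \<le> w" "c \<noteq> 0"
  shows "(LINT x|nu c u v w k. f x) = u * f (1, 0) + v * f (0, 1) + w * f (1, c powi (- k))"
proof -
  let ?A = "{(1, 0), (0, 1), (1, c powi (- k))} :: (real \<times> real) set"
  let ?m = "\<lambda>x :: real \<times> real. if x = (1, 0) then u else if x = (0, 1) then v else w"
  have "(\<lambda>x. x) \<in> point_measure ?A (\<lambda>x. ennreal (?m x)) \<rightarrow>\<^sub>M borel" by (simp add: point_measure_def)
  then have "(LINT x|nu c u v w k. f x) = (LINT x|point_measure ?A (\<lambda>x. ennreal (?m x)). f x)"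
    unfolding nu_def by (subst integral_distr) simp_all
  also have "\<dots> = (\<Sum>x\<in>?A. ?m x *\<^sub>R f x)"
    using assms by (intro lebesgue_integral_point_measure_finite) auto
  \<comment> \<open>Since \<open>c \<noteq> 0\<close>, the third atom differs from
    \<open>(1, 0)\<close> and its mass is counted separately.\<close>
  also have "\<dots> = u * f (1, 0) + v * f (0, 1) + w * f (1, c powi (- k))"
    using assms by (simp add: scaleR_conv_of_real)
  finally show ?thesis .
qed

lemma jump_process_if_compound_poisson_process:
  assumes cpp: "compound_poisson_process M (nu c u v w k) (\<lambda>t \<omega>. (N t \<omega>, L t \<omega>))"
    and "0 < u" "0 \<le> v" "0 < w" "c \<noteq> 0"
  shows "jump_process M N L u v w (c powi (- k))"
proof -
  have levy: "levy_process M (\<lambda>t \<omega>. (N t \<omega>, L t \<omega>))"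
    using cpp by (simp add: compound_poisson_process_def)
  then interpret prob_space M by (simp add: levy_process_def)
  show ?thesis
  proof
    fix t x y :: real assume t: "0 \<le> t"
    have [measurable]: "(\<lambda>p. iexp ((x, y) \<bullet> p) - 1) \<in> borel_measurable borel"
      by (intro borel_measurable_continuous_onI continuous_intros)
    have "(LINT \<omega>|M. iexp ((x, y) \<bullet> (N t \<omega>, L t \<omega>))) =
        exp (of_real t * (LINT p|nu c u v w k. (iexp ((x, y) \<bullet> p) - 1)))"
      using cpp t unfolding compound_poisson_process_def by blast
    also have "(LINT p|nu c u v w k. (iexp ((x, y) \<bullet> p) - 1)) =
        u * (iexp x - 1) + v * (iexp y - 1) + w * (iexp (x + c powi (- k) * y) - 1)"
      using assms by (subst integral_nu) (simp_all add: mult.commute)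
    finally show "(LINT \<omega>|M. iexp (x * N t \<omega> + y * L t \<omega>)) =
        exp (t * (u * (iexp x - 1) + v * (iexp y - 1) + w * (iexp (x + c powi (- k) * y) - 1)))"
      by simp
  qed (use levy assms in auto)
qed

theorem theorem5p2:
  fixes k :: nat and c p q r u v w :: real
    and M :: "'a measure" and N L :: "real \<Rightarrow> 'a \<Rightarrow> real"
  assumes "k \<ge> 1" and "c > 1"
    and "u \<ge> 0" and "v \<ge> 0" and "w \<ge> 0"
    and "p = u / (u + v + w)" and "q = v / (u + v + w)" and "r = w / (u + v + w)"
    and "p \<ge> 0" and "q \<ge> 0" and "r \<ge> 0" and "p + q + r = 1"
    and "0 < r" and "r < p"
    and "compound_poisson_process M (nu c u v w (int k)) (\<lambda>t \<omega>. (N t \<omega>, L t \<omega>))"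
  shows "infinitely_divisible (rho M N L) \<longleftrightarrow> c ^ k = 2 \<and> r\<^sup>2 \<le> p\<^sup>2 * q"
proof -
  define a where "a = c powi (- int k)"
  define s where "s = u + v + w"
  have "w \<noteq> 0" "u \<noteq> 0" using assms by auto
  then have wpos: "0 < u" "0 < w" "0 < s" using assms by (auto simp: s_def)
  interpret jump_process M N L u v w a
    unfolding a_def using assms wpos by (intro jump_process_if_compound_poisson_process) auto
  have a_eq: "a = 1 / c ^ k" by (simp add: a_def power_int_minus divide_inverse)
  have "1 < c ^ k" using assms(1,2) by (intro one_less_power) auto
  then have a: "0 < a" "a < 1" by (auto simp: a_eq)
  note params = a assms(13,14,10,12)
  have "char (rho M N L) = char (jump_law a p q r)"
  proof
    fix z
    have pqr: "u = s * p" "v = s * q" "w = s * r" "u + w + v = s"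
      using wpos assms by (auto simp: s_def)
    \<comment> \<open>The total mass \<open>s\<close> is factored out and cancels, which passes from
      \<open>u\<close>, \<open>v\<close>, \<open>w\<close> to \<open>p\<close>, \<open>q\<close>,
      \<open>r\<close>.\<close>
    have "char (rho M N L) z = of_real s * (p + r * iexp (a * z)) / (of_real s * (1 - q * iexp z))"
      unfolding char_rho pqr(4) by (simp add: pqr(1-3) algebra_simps)
    also have "\<dots> = (p + r * iexp (a * z)) / (1 - q * iexp z)" using wpos by simp
    also have "\<dots> = char (jump_law a p q r) z" by (rule char_jump_law[OF params, symmetric])
    finally show "char (rho M N L) z = char (jump_law a p q r) z" .
  qed
  then have "rho M N L = jump_law a p q r"
    by (intro Levy_uniqueness real_distribution_rho real_distribution_jump_law params)
  moreover have "a = 1 / 2 \<longleftrightarrow> c ^ k = 2"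
  proof -
    have "1 / x = 1 / 2 \<longleftrightarrow> x = 2" for x :: real by (auto simp: field_simps)
    then show ?thesis unfolding a_eq .
  qed
  ultimately show ?thesis by (simp add: infinitely_divisible_jump_law_iff[OF params])
qed

end
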